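(* Let $n\ge 1$, $1\le p<\infty$, $0\leq\gamma<1$, $1\leq q<\infty$ and $0\leq\alpha<\frac{1}{q}$. Define $r$ by $\frac{1}{q}-\frac{1}{r}=\alpha$, and let $(w,v)$ be a pair of weights on $\mathbb{R}^{n+1}$ with $(w,v)\in A^+_{q,r}(\gamma)$; that is, if $q>1$ (with $q'=\frac{q}{q-1}$), $$[(w,v)]_{A^+_{q,r}(\gamma)} = \sup_{R \subset \mathbb{R}^{n+1}} \biggl( \frac{1}{|R^-(\gamma)|}\int_{R^-(\gamma)} w^r \,dx\,dt \biggr)^{\frac{1}{r}} \biggl( \frac{1}{|R^+(\gamma)|}\int_{R^+(\gamma)} v^{-q'} \,dx\,dt \biggr)^{\frac{1}{q'}} < \infty,$$ and if $q=1$, $$[(w,v)]_{A^+_{1,r}(\gamma)} = \sup_{R\subset \mathbb{R}^{n+1}} \Bigl(\operatorname*{ess\,inf}_{(x,t)\in R^+(\gamma)} v(x,t)\Bigr)^{-1} \biggl( \frac{1}{|R^-(\gamma)|}\int_{R^-(\gamma)} w^r \,dx\,dt \biggr)^{\frac{1}{r}} <\infty,$$ where the suprema are over all parabolic rectangles $R\subset\mathbb{R}^{n+1}$. Then there is a constant $C=C(n,p,\gamma,q,r,\alpha)$ such that $$w^r\bigl( \{ M^{\gamma+}_{\alpha, c} f > \lambda \}\bigr) \leq [(w,v)]_{A_{q,r}^+(\gamma)}^r \,\frac{C}{\lambda^r} \biggl( \int_{\mathbb{R}^{n+1}} |f|^q \, v^q \,dx\,dt \biggr)^{\frac{r}{q}}$$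 for every $\lambda>0$ and every $f\in L^1_{\mathrm{loc}}(\mathbb{R}^{n+1})$.
   Context: Write points of $\mathbb{R}^{n+1}$ as $(x,t)$ with $x\in\mathbb{R}^n$, $t\in\mathbb{R}$; $|A|$ is the Lebesgue measure of $A\subset\mathbb{R}^{n+1}$. The parameter $1\le p<\infty$ is fixed. For $x\in\mathbb{R}^n$ and $L>0$, let $Q(x,L)=\{y\in\mathbb{R}^n: |y_i-x_i|\le L/2,\ i=1,\dots,n\}$. A parabolic rectangle centered at $(x,t)$ with sidelength $L>0$ is $R=R(x,t,L,p)=Q(x,L)\times(t-L^p,t+L^p)$. For $0\le\gamma<1$ (the time lag), its upper and lower parts are $$R^+(\gamma)=Q(x,L)\times(t+\gamma L^p,t+L^p),\qquad R^-(\gamma)=Q(x,L)\times(t-L^p,t-\gamma L^p),$$ and $z(R^{\pm}(\gamma))$ denotes the center point of $R^{\pm}(\gamma)$. A weight is a nonnegative measurable function on $\mathbb{R}^{n+1}$. For a weight $u$ and a measurable set $A$, $u(A)=\int_A u\,dx\,dt$; in particular $w^r(A)=\int_A w^r\,dx\,dt$. The convention $0\cdot\infty=0$ is used in the products above. For $f\in L^1_{\mathrm{loc}}(\mathbb{R}^{n+1})$ and $0\le\alpha<1$, the centered forward in time parabolic fractional maximal function is $$M^{\gamma+}_{\alpha,c} f(x,t)=\sup_{z(R^-(\gamma))=(x,t)} |R^+(\gamma)|^{\alpha}\,\frac{1}{|R^+(\gamma)|}\int_{R^+(\gamma)}|f|,$$ the supremum being over all parabolic rectangles $R\subset\mathbb{R}^{n+1}$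 such that $(x,t)$ is the center point of $R^-(\gamma)$. *)

theory Defs
  imports "HOL-Analysis.Analysis"
begin

text \<open>
  Space-time is \<open>(real ^ 'n) \<times> real\<close> with \<open>n = CARD('n)\<close>, carrying Lebesgue measure \<open>lebesgue\<close>.
  Since integrals of nonnegative functions may be infinite, they are taken in \<open>ennreal\<close>,
  where \<open>0 * \<infinity> = 0\<close>, \<open>inverse 0 = \<infinity>\<close> and \<open>inverse \<infinity> = 0\<close>.
\<close>

text \<open>Only used with exponents \<open>a > 0\<close>, so that \<open>0\<^sup>a = 0\<close> and \<open>\<infinity>\<^sup>a = \<infinity>\<close>.\<close>

definition epowr :: "ennreal \<Rightarrow> real \<Rightarrow> ennreal" where
  "epowr b a = (if b = \<infinity> then \<infinity> else ennreal (enn2real b powr a))"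

definition cube :: "real ^ 'n \<Rightarrow> real \<Rightarrow> (real ^ 'n) set" where
  "cube x L = {y. \<forall>i. \<bar>y $ i - x $ i\<bar> \<le> L / 2}"

text \<open>
  A parabolic rectangle \<open>R(x, t, L, p)\<close> is represented by its centre \<open>(x, t)\<close> and its
  sidelength \<open>L > 0\<close>; the next two sets are \<open>R\<^sup>+(\<gamma>)\<close> and \<open>R\<^sup>-(\<gamma>)\<close>.
\<close>

definition upper_part :: "real \<Rightarrow> real \<Rightarrow> real ^ 'n \<Rightarrow> real \<Rightarrow> real \<Rightarrow> ((real ^ 'n) \<times> real) set" where
  "upper_part p \<gamma> x t L = cube x L \<times> {t + \<gamma> * L powr p <..< t + L powr p}"

definition lower_part :: "real \<Rightarrow> real \<Rightarrow> real ^ 'n \<Rightarrow> real \<Rightarrow> real \<Rightarrow> ((real ^ 'n) \<times> real) set" where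
  "lower_part p \<gamma> x t L = cube x L \<times> {t - L powr p <..< t - \<gamma> * L powr p}"

definition lower_center :: "real \<Rightarrow> real \<Rightarrow> real ^ 'n \<Rightarrow> real \<Rightarrow> real \<Rightarrow> (real ^ 'n) \<times> real" where
  "lower_center p \<gamma> x t L = (x, midpoint (t - L powr p) (t - \<gamma> * L powr p))"

definition weight :: "((real ^ 'n) \<times> real \<Rightarrow> real) \<Rightarrow> bool" where
  "weight u \<longleftrightarrow> u \<in> borel_measurable lebesgue \<and> (\<forall>z. 0 \<le> u z)"

definition locally_integrable :: "((real ^ 'n) \<times> real \<Rightarrow> real) \<Rightarrow> bool" where
  "locally_integrable f \<longleftrightarrow> (\<forall>K. compact K \<longrightarrow> f absolutely_integrable_on K)"

definition average :: "((real ^ 'n) \<times> real) set \<Rightarrow> ((real ^ 'n) \<times> real \<Rightarrow> ennreal) \<Rightarrow> ennreal" where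
  "average A g = (\<integral>\<^sup>+z\<in>A. g z \<partial>lebesgue) / emeasure lebesgue A"

definition ess_inf_on :: "((real ^ 'n) \<times> real) set \<Rightarrow> ((real ^ 'n) \<times> real \<Rightarrow> ennreal) \<Rightarrow> ennreal" where
  "ess_inf_on A g = Sup {c. AE z\<in>A in lebesgue. c \<le> g z}"

text \<open>
  The constant \<open>[(w, v)]\<close> of the class \<open>A\<^sup>+\<^sub>q\<^sub>,\<^sub>r(\<gamma>)\<close>. The negative power of \<open>v\<close> is formed in
  \<open>ennreal\<close>, because it has to be infinite where \<open>v\<close> vanishes, whereas \<open>0 powr a = 0\<close> over the reals.
\<close>

definition A_const :: "real \<Rightarrow> real \<Rightarrow> real \<Rightarrow> real \<Rightarrow> ((real ^ 'n) \<times> real \<Rightarrow> real)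
    \<Rightarrow> ((real ^ 'n) \<times> real \<Rightarrow> real) \<Rightarrow> ennreal" where
  "A_const p \<gamma> q r w v =
    (if q = 1 then
      Sup {inverse (ess_inf_on (upper_part p \<gamma> x t L) (\<lambda>z. ennreal (v z)))
             * epowr (average (lower_part p \<gamma> x t L) (\<lambda>z. ennreal (w z powr r))) (1 / r)
           | x t L. 0 < L}
     else
      (let q' = q / (q - 1) in
      Sup {epowr (average (lower_part p \<gamma> x t L) (\<lambda>z. ennreal (w z powr r))) (1 / r)
             * epowr (average (upper_part p \<gamma> x t L) (\<lambda>z. epowr (inverse (ennreal (v z))) q')) (1 / q')
           | x t L. 0 < L}))"

definition maximal_fun :: "real \<Rightarrow> real \<Rightarrow> real \<Rightarrow> ((real ^ 'n) \<times> real \<Rightarrow> real)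
    \<Rightarrow> (real ^ 'n) \<times> real \<Rightarrow> ennreal" where
  "maximal_fun p \<gamma> \<alpha> f z =
    Sup {ennreal (measure lebesgue (upper_part p \<gamma> x t L) powr \<alpha>)
           * average (upper_part p \<gamma> x t L) (\<lambda>y. ennreal \<bar>f y\<bar>)
         | x t L. 0 < L \<and> lower_center p \<gamma> x t L = z}"

end

theory Submission
  imports Defs
begin

text \<open>
  Write \<open>a = [(w, v)]\<close> and \<open>g = |f|\<^sup>q v\<^sup>q\<close>. For a rectangle \<open>R\<close> and any
  \<open>F \<subseteq> R\<^sup>+\<close> carrying half of the integral of \<open>|f|\<close> over \<open>R\<^sup>+\<close>, Hoelder's inequality and the
  definition of \<open>a\<close> give
  \<open>(lam/2)\<^sup>q w\<^sup>r(R\<^sup>-)\<^bsup>1 - q \<alpha>\<^esup> \<le> a\<^sup>q g(F)\<close> as soon as the fractional average of \<open>|f|\<close> over \<open>R\<^sup>+\<close>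
  exceeds \<open>lam\<close>. Choose such an \<open>R\<close> for every point of the level set. A dyadic decomposition of the
  set according to the value of the fractional average, whose contributions sum as a
  geometric series, reduces to the case that all averages lie in \<open>[lam, 2 lam]\<close>.

  A Vitali selection provides rectangles \<open>R\<^sub>i\<close> whose lower parts cover, while the concentric
  lower parts shrunk by \<open>3\<close> are disjoint. Nothing bounds the overlap of the upper parts \<open>R\<^sub>i\<^sup>+\<close>,
  but by disjointness the volumes of the smaller \<open>R\<^sub>j\<close> with \<open>R\<^sub>j\<^sup>+\<close> meeting
  \<open>R\<^sub>i\<^sup>+\<close> add up to at most \<open>K |R\<^sub>i|\<close>. With \<open>w\<^sub>i = w\<^sup>r(R\<^sub>i\<^sup>-)\<close> and \<open>W = \<Sum> w\<^sub>i\<close>, Hoelder's and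
  Markov's inequalities then show that at least half of the integral of \<open>|f|\<close> over \<open>R\<^sub>i\<^sup>+\<close> lies in
  the set \<open>F\<^sub>i\<close> of those points at which the sum of \<open>w\<^sub>j\<^sup>\<alpha>\<close> over the smaller \<open>R\<^sub>j\<^sup>+\<close> is at most
  \<open>4 K W\<^sup>\<alpha>\<close>. The sets \<open>F\<^sub>i\<close> satisfy \<open>\<Sum> w\<^sub>i\<^bsup>q \<alpha>\<^esup> 1\<^bsub>F\<^sub>i\<^esub> \<le> (4 K)\<^sup>q W\<^bsup>q \<alpha>\<^esup>\<close>, whence
  \<open>W = \<Sum> w\<^sub>i\<^bsup>q \<alpha>\<^esup> w\<^sub>i\<^bsup>1 - q \<alpha>\<^esup>\<close> is controlled by \<open>W\<^bsup>q \<alpha>\<^esup>\<close> times the integral of \<open>g\<close>.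
\<close>

section \<open>Vitali selection and Hoelder inequalities\<close>

text \<open>Greedy choice: keep a member \<open>m\<close> of maximal size, discard everything whose
  set meets \<open>P m\<close>, and recurse on the rest. Nonemptiness of \<open>P m\<close> makes
  \<open>m\<close> itself discarded, so the recursion terminates.\<close>

lemma finite_Vitali_selection:
  fixes Z :: "'i set" and P :: "'i \<Rightarrow> 'a set" and size :: "'i \<Rightarrow> real"
  assumes "finite Z" and "\<And>z. z \<in> Z \<Longrightarrow> P z \<noteq> {}"
  shows "\<exists>S\<subseteq>Z. disjoint_family_on P S \<and> (\<forall>z\<in>Z. \<exists>s\<in>S. size z \<le> size s \<and> P z \<inter> P s \<noteq> {})"
  using assms
proof (induction Z rule: finite_psubset_induct)
  case (psubset Z)
  show ?case
  proof (cases "Z = {}")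
    case False
    obtain m where m: "m \<in> Z" "\<And>z. z \<in> Z \<Longrightarrow> size z \<le> size m"
      using Max_in[of "size ` Z"] Max_ge[of "size ` Z"] psubset.hyps False
      by (metis (no_types, lifting) finite_imageI image_iff image_is_empty)
    define Z' where "Z' = {z \<in> Z. P z \<inter> P m = {}}"
    have "Z' \<subset> Z" using m psubset.prems by (auto simp: Z'_def)
    then obtain S where S: "S \<subseteq> Z'" "disjoint_family_on P S"
      "\<forall>z\<in>Z'. \<exists>s\<in>S. size z \<le> size s \<and> P z \<inter> P s \<noteq> {}"
      using psubset.IH[of Z'] psubset.prems by (auto simp: Z'_def)
    have "disjoint_family_on P (insert m S)"
      using S(1,2) unfolding disjoint_family_on_def Z'_def by (auto; blast)
    moreover have "\<forall>z\<in>Z. \<exists>s\<in>insert m S. size z \<le> size s \<and> P z \<inter> P s \<noteq> {}"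
      using S(3) m unfolding Z'_def by blast
    ultimately show ?thesis using S(1) m(1) by (intro exI[of _ "insert m S"]) (auto simp: Z'_def)
  qed (auto simp: disjoint_family_on_def)
qed

text \<open>After dividing by the two sums, this is weighted AM-GM term by term. Stating it with
  exponents \<open>1 - \<alpha>\<close> and \<open>\<alpha>\<close> includes the endpoint
  \<open>\<alpha> = 0\<close>, the non-fractional case.\<close>

lemma sum_powr_Holder:
  fixes x y :: "'i \<Rightarrow> real"
  assumes "finite J" and pos: "\<And>j. j \<in> J \<Longrightarrow> 0 < x j" "\<And>j. j \<in> J \<Longrightarrow> 0 < y j" and "0 \<le> \<alpha>" "\<alpha> \<le> 1"
  shows "(\<Sum>j\<in>J. x j powr (1 - \<alpha>) * y j powr \<alpha>) \<le> sum x J powr (1 - \<alpha>) * sum y J powr \<alpha>"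
proof (cases "J = {}")
  case False
  define X Y where "X = sum x J" and "Y = sum y J"
  have XY: "0 < X" "0 < Y" using assms False by (auto simp: X_def Y_def intro: sum_pos)
  have "(\<Sum>j\<in>J. (x j / X) powr (1 - \<alpha>) * (y j / Y) powr \<alpha>) \<le> (\<Sum>j\<in>J. (1 - \<alpha>) * (x j / X) + \<alpha> * (y j / Y))"
  proof (rule sum_mono)
    fix j assume "j \<in> J"
    show "(x j / X) powr (1 - \<alpha>) * (y j / Y) powr \<alpha> \<le> (1 - \<alpha>) * (x j / X) + \<alpha> * (y j / Y)"
      using Youngs_inequality_0[of "1-\<alpha>" "\<alpha>" "x j / X" "y j / Y"] XY pos[OF \<open>j \<in> J\<close>] assms by simp
  qed
  also have "\<dots> = (1 - \<alpha>) * (X / X) + \<alpha> * (Y / Y)"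
    unfolding X_def Y_def by (simp add: sum.distrib sum_distrib_left[symmetric] sum_divide_distrib[symmetric] flip: times_divide_eq_right)
  also have "\<dots> = 1" using XY by simp
  finally have "(\<Sum>j\<in>J. (x j powr (1 - \<alpha>) * y j powr \<alpha>) / (X powr (1 - \<alpha>) * Y powr \<alpha>)) \<le> 1"
    by (simp add: powr_divide)
  then show ?thesis using XY by (simp add: sum_divide_distrib[symmetric] X_def Y_def divide_le_eq)
qed auto

text \<open>Hoelder's inequality for the product of \<open>f v\<close> and \<open>1 / v\<close>,
  raised to the power \<open>q\<close>. It is obtained by integrating Young's inequality with a free
  scaling parameter \<open>s\<close> and then optimising \<open>s\<close>.\<close>

lemma nn_integral_weighted_Holder:
  fixes f v :: "'a \<Rightarrow> real"
  assumes q: "1 < q" and [measurable]: "f \<in> borel_measurable M" "v \<in> borel_measurable M" "F \<in> sets M"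
    and nonneg: "\<And>z. 0 \<le> f z" "\<And>z. 0 \<le> v z"
    and Y: "(\<integral>\<^sup>+z\<in>F. epowr (inverse (ennreal (v z))) (q / (q - 1)) \<partial>M) \<le> ennreal Y" "0 < Y"
    and c: "0 \<le> c" "ennreal c \<le> (\<integral>\<^sup>+z\<in>F. ennreal (f z) \<partial>M)"
  shows "ennreal (c powr q) \<le> ennreal (Y powr (q - 1)) * (\<integral>\<^sup>+z\<in>F. ennreal (f z powr q * v z powr q) \<partial>M)"
proof (cases "(\<integral>\<^sup>+z\<in>F. ennreal (f z powr q * v z powr q) \<partial>M)" rule: ennreal_cases)
  case (real x)
  define q' where "q' = q / (q - 1)"
  have q': "1 < q'" "1 / q + 1 / q' = 1" "q + q' = q * q'" using q by (auto simp: q'_def field_simps)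
  have epm[measurable]: "(\<lambda>z. epowr (inverse (ennreal (v z))) q') \<in> borel_measurable M"
    unfolding epowr_def by measurable
  have "(\<integral>\<^sup>+z. epowr (inverse (ennreal (v z))) q' * indicator F z \<partial>M) \<noteq> \<infinity>"
    using Y(1) unfolding q'_def by (auto simp: top_unique)
  then have "AE z in M. epowr (inverse (ennreal (v z))) q' * indicator F z \<noteq> \<infinity>"
    by (intro nn_integral_noteq_infinite) measurable
  \<comment> \<open>Where \<open>v\<close> vanishes, its negative power is
    \<open>\<infinity>\<close> in \<open>ennreal\<close>, so a finite integral leaves only a null
    set of such points in \<open>F\<close>.\<close>
  then have vpos: "AE z in M. z \<in> F \<longrightarrow> 0 < v z"
  proof eventually_elim
    case (elim z)
    then show ?case using nonneg(2)[of z] by (cases "v z = 0") (auto simp: epowr_def)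
  qed
  have young: "c \<le> s powr q * x / q + s powr (- q') * Y / q'" if s: "0 < s" for s
  proof -
    have "ennreal c \<le> (\<integral>\<^sup>+z. ennreal (f z) * indicator F z \<partial>M)" by (rule c)
    also have "\<dots> \<le> (\<integral>\<^sup>+z. ennreal (s powr q / q) * (ennreal (f z powr q * v z powr q) * indicator F z)
         + ennreal (s powr (- q') / q') * (epowr (inverse (ennreal (v z))) q' * indicator F z) \<partial>M)"
    proof (rule nn_integral_mono_AE, use vpos in eventually_elim)
      case (elim z)
      show ?case
      proof (cases "z \<in> F")
        case True
        then have v: "0 < v z" using elim by auto
        have "f z = (f z * v z * s) * (1 / (v z * s))" using v s by simp
        also have "\<dots> \<le> (f z * v z * s) powr q / q + (1 / (v z * s)) powr q' / q'"
          by (rule Youngs_inequality) (use q q' v s nonneg in auto)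
        also have "\<dots> = (s powr q / q) * (f z powr q * v z powr q) + (s powr (- q') / q') * ((1 / v z) powr q')"
          using v s by (simp add: powr_mult powr_divide powr_minus field_simps)
        finally have "ennreal (f z) \<le> ennreal ((s powr q / q) * (f z powr q * v z powr q) + (s powr (- q') / q') * ((1 / v z) powr q'))"
          by (rule ennreal_leI)
        also have "\<dots> = ennreal (s powr q / q) * ennreal (f z powr q * v z powr q) + ennreal (s powr (- q') / q') * ennreal ((1 / v z) powr q')"
          using q q' s v by (simp add: ennreal_mult[symmetric] del: ennreal_plus flip: ennreal_plus)
        also have "ennreal ((1 / v z) powr q') = epowr (inverse (ennreal (v z))) q'"
          using v by (simp add: epowr_def inverse_ennreal inverse_eq_divide[symmetric])
        finally show ?thesis using True by simp
      qed auto
    qed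
    also have "\<dots> = ennreal (s powr q / q) * (\<integral>\<^sup>+z. (ennreal (f z powr q * v z powr q) * indicator F z)\<partial>M)
         + ennreal (s powr (- q') / q') * (\<integral>\<^sup>+z. (epowr (inverse (ennreal (v z))) q' * indicator F z) \<partial>M)"
      by (simp add: nn_integral_add nn_integral_cmult)
    also have "\<dots> \<le> ennreal (s powr q / q) * ennreal x + ennreal (s powr (- q') / q') * ennreal Y"
      using Y real by (intro add_mono mult_left_mono) (auto simp: q'_def)
    also have "\<dots> = ennreal (s powr q * x / q + s powr (- q') * Y / q')"
      using q q' real Y by (simp add: ennreal_plus ennreal_mult'[symmetric])
    finally show ?thesis using q q' real Y by (subst (asm) ennreal_le_iff) auto
  qed
  have "c powr q \<le> Y powr (q - 1) * x"
  proof (rule field_le_epsilon)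
    fix e :: real assume e: "0 < e"
    \<comment> \<open>The optimal \<open>s\<close> involves \<open>Y / x\<close>, and
      \<open>x\<close> may be 0. The perturbation makes the denominator positive and costs exactly
      \<open>e\<close> once multiplied by \<open>Y powr (q - 1)\<close>.\<close>
    define x' where "x' = x + e / Y powr (q - 1)"
    have x': "0 < x'" "x \<le> x'" using e Y real by (auto simp: x'_def add_nonneg_pos)
    \<comment> \<open>This \<open>s\<close> balances the two terms of Young's inequality.\<close>
    define s where "s = (Y / x') powr (1 / (q * q'))"
    have s: "0 < s" using x' Y by (simp add: s_def)
    have e1: "q * (1 / (q * q')) = 1 / q'" "1 / q' = 1 - 1 / q" "q' * (1 / (q * q')) = 1 / q" using q q' by (auto simp: field_simps)
    have "s powr q = (Y / x') powr (1 - 1 / q)" unfolding s_def powr_powr using e1 by (simp add: mult.commute)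
    then have 1: "s powr q * x' = Y powr (1 - 1 / q) * x' powr (1 / q)"
      using x' by (simp add: powr_divide powr_diff)
    have "s powr (- q') = (Y / x') powr (- (1 / q))" unfolding s_def powr_powr using e1 by (simp add: mult.commute)
    then have 2: "s powr (- q') * Y = Y powr (1 - 1 / q) * x' powr (1 / q)"
      using x' Y by (simp add: powr_divide powr_diff powr_minus_divide)
    have "c \<le> s powr q * x / q + s powr (- q') * Y / q'" using young[OF s] .
    also have "\<dots> \<le> s powr q * x' / q + s powr (- q') * Y / q'"
      using x' q q'(1) by (intro add_mono divide_right_mono mult_left_mono) auto
    also have "\<dots> = Y powr (1 - 1 / q) * x' powr (1 / q) * (1 / q + 1 / q')"
      unfolding 1 2 by (simp add: algebra_simps)
    finally have "c \<le> Y powr (1 - 1 / q) * x' powr (1 / q)" using q' by simp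
    then have "c powr q \<le> (Y powr (1 - 1 / q) * x' powr (1 / q)) powr q"
      using c q by (intro powr_mono2) auto
    also have "\<dots> = Y powr (q - 1) * x'"
      using x' q by (simp add: powr_mult powr_powr left_diff_distrib)
    also have "\<dots> = Y powr (q - 1) * x + e" using Y by (simp add: x'_def field_simps)
    finally show "c powr q \<le> Y powr (q - 1) * x + e" .
  qed
  then show ?thesis using real by (simp add: ennreal_mult'[symmetric] ennreal_leI)
next
  case top
  then show ?thesis using Y by (simp add: ennreal_mult_top)
qed

section \<open>Weak-type estimate for an abstract sparse family\<close>

text \<open>In the application \<open>U i\<close> is an upper part, \<open>\<kappa> i\<close> its
  volume and \<open>w i\<close> the weighted mass of the lower part. The sets \<open>U i\<close> may
  overlap without bound, but by \<open>sparse\<close> the points of \<open>U i\<close> covered too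
  often by smaller members carry at most half of the integral of \<open>f\<close>. The remaining
  sets have bounded weighted overlap, so the local estimates \<open>weak\<close> can be
  summed.\<close>

lemma sparse_family_weak_type:
  fixes U :: "'i \<Rightarrow> 'a set" and f g :: "'a \<Rightarrow> ennreal" and \<kappa> w size :: "'i \<Rightarrow> real"
  assumes S: "finite S"
    and U[measurable]: "\<And>i. i \<in> S \<Longrightarrow> U i \<in> sets M"
    and [measurable]: "f \<in> borel_measurable M" "g \<in> borel_measurable M"
    and pos: "\<And>i. i \<in> S \<Longrightarrow> 0 < \<kappa> i" "\<And>i. i \<in> S \<Longrightarrow> 0 < w i"
    and \<alpha>: "0 \<le> \<alpha>" "\<alpha> \<le> 1" and q: "1 \<le> q" and lam: "0 < lam" and K: "1 \<le> K"
    and lower: "\<And>i. i \<in> S \<Longrightarrow> ennreal (lam * \<kappa> i powr (1 - \<alpha>)) \<le> (\<integral>\<^sup>+y\<in>U i. f y \<partial>M)"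
    and upper: "\<And>i. i \<in> S \<Longrightarrow> (\<integral>\<^sup>+y\<in>U i. f y \<partial>M) \<le> ennreal (2 * lam * \<kappa> i powr (1 - \<alpha>))"
    and sparse: "\<And>i. i \<in> S \<Longrightarrow> (\<Sum>j\<in>{j\<in>S. size j \<le> size i \<and> U j \<inter> U i \<noteq> {}}. \<kappa> j) \<le> K * \<kappa> i"
    and weak: "\<And>i F. \<lbrakk>i \<in> S; F \<in> sets M; F \<subseteq> U i; ennreal (lam / 2 * \<kappa> i powr (1 - \<alpha>)) \<le> (\<integral>\<^sup>+y\<in>F. f y \<partial>M)\<rbrakk>
        \<Longrightarrow> ennreal (w i powr (1 - q * \<alpha>)) \<le> B * (\<integral>\<^sup>+y\<in>F. g y \<partial>M)"
  shows "ennreal (sum w S powr (1 - q * \<alpha>)) \<le> ennreal ((4 * K) powr q) * B * (\<integral>\<^sup>+y. g y \<partial>M)"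
proof (cases "S = {}")
  case False
  define W where "W = sum w S"
  have W: "0 < W" using S False pos by (auto simp: W_def intro: sum_pos)
  define J where "J i = {j\<in>S. size j \<le> size i \<and> U j \<inter> U i \<noteq> {}}" for i
  have J: "J i \<subseteq> S" "finite (J i)" for i using S by (auto simp: J_def)
  \<comment> \<open>The weighted overlap seen from \<open>i\<close> counts only members no larger
    than \<open>i\<close> that meet \<open>U i\<close>, which are those whose total
    \<open>\<kappa>\<close> is controlled by \<open>sparse\<close>.\<close>
  define h where "h i y = (\<Sum>j\<in>J i. w j powr \<alpha> * indicator (U j) y)" for i y
  have h0: "0 \<le> h i y" for i y unfolding h_def by (intro sum_nonneg) auto
  \<comment> \<open>The 4 is a factor 2 between \<open>lower\<close> and \<open>upper\<close> times
    a factor 2 for losing at most half of the mass.\<close>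
  define T where "T = 4 * K * W powr \<alpha>"
  have T: "0 < T" using K W by (simp add: T_def)
  define F where "F i = {y \<in> space M. h i y \<le> T} \<inter> U i" for i
  have hm[measurable]: "h i \<in> borel_measurable M" for i
    unfolding h_def using J(1)[of i] by (intro borel_measurable_sum borel_measurable_times borel_measurable_const borel_measurable_indicator U) auto
  have F[measurable]: "F i \<in> sets M" if "i \<in> S" for i
    unfolding F_def using U[OF that] by measurable
  \<comment> \<open>Markov's inequality for the measure \<open>f dM\<close>: at most half of the mass of \<open>U i\<close> lies outside \<open>F i\<close>.\<close>
  have half: "ennreal (lam / 2 * \<kappa> i powr (1 - \<alpha>)) \<le> (\<integral>\<^sup>+y\<in>F i. f y \<partial>M)" if i: "i \<in> S" for i
  proof -
    note [measurable] = F[OF i] U[OF i]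
    let ?k = "\<kappa> i powr (1 - \<alpha>)"
    have "ennreal T * (\<integral>\<^sup>+y\<in>U i - F i. f y \<partial>M) = (\<integral>\<^sup>+y. ennreal T * (f y * indicator (U i - F i) y) \<partial>M)"
      by (rule nn_integral_cmult[symmetric]) measurable
    also have "\<dots> \<le> (\<integral>\<^sup>+y. (\<Sum>j\<in>J i. ennreal (w j powr \<alpha>) * (f y * indicator (U j) y)) \<partial>M)"
    proof (rule nn_integral_mono)
      fix y assume y: "y \<in> space M"
      show "ennreal T * (f y * indicator (U i - F i) y) \<le> (\<Sum>j\<in>J i. ennreal (w j powr \<alpha>) * (f y * indicator (U j) y))"
      proof (cases "y \<in> U i - F i")
        case True
        then have "T \<le> h i y" using y by (auto simp: F_def)
        then have "ennreal T \<le> ennreal (h i y)" by (rule ennreal_leI)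
        also have "\<dots> = (\<Sum>j\<in>J i. ennreal (w j powr \<alpha>) * indicator (U j) y)"
          unfolding h_def by (subst sum_ennreal[symmetric]) (auto intro!: sum.cong simp del: sum_ennreal split: split_indicator)
        finally have "ennreal T * f y \<le> (\<Sum>j\<in>J i. ennreal (w j powr \<alpha>) * indicator (U j) y) * f y"
          by (rule mult_right_mono) simp
        then show ?thesis using True by (simp add: sum_distrib_right sum_distrib_left mult_ac)
      qed simp
    qed
    also have "\<dots> = (\<Sum>j\<in>J i. ennreal (w j powr \<alpha>) * (\<integral>\<^sup>+y\<in>U j. f y \<partial>M))"
    proof -
      have m: "(\<lambda>y. f y * indicator (U j) y) \<in> borel_measurable M" if "j \<in> J i" for j
      proof -
        have [measurable]: "U j \<in> sets M" using that J(1)[of i] U by auto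
        show ?thesis by measurable
      qed
      show ?thesis
        using m by (simp add: nn_integral_sum nn_integral_cmult)
    qed
    also have "\<dots> \<le> (\<Sum>j\<in>J i. ennreal (w j powr \<alpha>) * ennreal (2 * lam * \<kappa> j powr (1 - \<alpha>)))"
      using J(1)[of i] by (intro sum_mono mult_left_mono upper) auto
    also have "\<dots> = ennreal (\<Sum>j\<in>J i. w j powr \<alpha> * (2 * lam * \<kappa> j powr (1 - \<alpha>)))"
      using lam by (subst sum_ennreal[symmetric]) (auto simp: ennreal_mult' simp del: sum_ennreal)
    also have "\<dots> \<le> ennreal (2 * lam * (K * ?k * W powr \<alpha>))"
    proof (rule ennreal_leI)
      have "(\<Sum>j\<in>J i. w j powr \<alpha> * (2 * lam * \<kappa> j powr (1 - \<alpha>))) = 2 * lam * (\<Sum>j\<in>J i. \<kappa> j powr (1 - \<alpha>) * w j powr \<alpha>)"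
        by (simp add: sum_distrib_left mult_ac)
      \<comment> \<open>Hoelder separates the volumes, summed by \<open>sparse\<close>, from the
        masses, whose sum is at most \<open>W\<close>.\<close>
      also have "\<dots> \<le> 2 * lam * (sum \<kappa> (J i) powr (1 - \<alpha>) * sum w (J i) powr \<alpha>)"
        using J(1)[of i] J(2) pos \<alpha> lam by (intro mult_left_mono sum_powr_Holder) auto
      also have "\<dots> \<le> 2 * lam * ((K * \<kappa> i) powr (1 - \<alpha>) * W powr \<alpha>)"
      proof (intro mult_left_mono mult_mono powr_mono2)
        show "sum \<kappa> (J i) \<le> K * \<kappa> i" using sparse[OF i] by (simp add: J_def)
        show "0 \<le> sum \<kappa> (J i)" "0 \<le> sum w (J i)" using J(1)[of i] pos by (auto intro!: sum_nonneg intro: less_imp_le)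
        show "sum w (J i) \<le> W" unfolding W_def using J(1)[of i] S pos by (intro sum_mono2) (auto intro: less_imp_le)
      qed (use \<alpha> lam in auto)
      also have "\<dots> = 2 * lam * (K powr (1 - \<alpha>) * ?k * W powr \<alpha>)" by (simp add: powr_mult)
      also have "\<dots> \<le> 2 * lam * (K powr 1 * ?k * W powr \<alpha>)"
        using K \<alpha> lam by (intro mult_left_mono mult_right_mono powr_mono) auto
      finally show "(\<Sum>j\<in>J i. w j powr \<alpha> * (2 * lam * \<kappa> j powr (1 - \<alpha>))) \<le> 2 * lam * (K * ?k * W powr \<alpha>)"
        using K by simp
    qed
    also have "2 * lam * (K * ?k * W powr \<alpha>) = T * (lam / 2 * ?k)" by (simp add: T_def)
    finally have "ennreal T * (\<integral>\<^sup>+y\<in>U i - F i. f y \<partial>M) \<le> ennreal T * ennreal (lam / 2 * ?k)"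
      using T lam by (subst ennreal_mult[symmetric]) auto
    then have bad: "(\<integral>\<^sup>+y\<in>U i - F i. f y \<partial>M) \<le> ennreal (lam / 2 * ?k)"
      using T by (subst (asm) ennreal_mult_le_mult_iff) auto
    have "ennreal (lam / 2 * ?k) + ennreal (lam / 2 * ?k) = ennreal (lam * ?k)"
      using lam by (simp flip: ennreal_plus)
    also have "\<dots> \<le> (\<integral>\<^sup>+y\<in>U i. f y \<partial>M)" by (rule lower[OF i])
    also have "\<dots> = (\<integral>\<^sup>+y. f y * indicator (F i) y + f y * indicator (U i - F i) y \<partial>M)"
      by (intro nn_integral_cong) (auto simp: F_def split: split_indicator)
    also have "\<dots> = (\<integral>\<^sup>+y\<in>F i. f y \<partial>M) + (\<integral>\<^sup>+y\<in>U i - F i. f y \<partial>M)"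
      by (rule nn_integral_add) measurable
    also have "\<dots> \<le> (\<integral>\<^sup>+y\<in>F i. f y \<partial>M) + ennreal (lam / 2 * ?k)" using bad by (rule add_left_mono)
    finally show ?thesis by (simp add: ennreal_add_left_cancel_le add.commute)
  qed
  \<comment> \<open>The first factor is absorbed by the overlap bound, the second by
    \<open>weak\<close>.\<close>
  have wq: "w i powr (q * \<alpha>) * w i powr (1 - q * \<alpha>) = w i" if "i \<in> S" for i
    using pos(2)[OF that] by (simp flip: powr_add)
  have overlap: "(\<Sum>i\<in>S. w i powr (q * \<alpha>) * indicator (F i) y) \<le> T powr q" for y
  proof (cases "\<exists>i\<in>S. y \<in> F i")
    case True
    define I where "I = {i\<in>S. y \<in> F i}"
    have I: "finite I" "I \<noteq> {}" using True S by (auto simp: I_def)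
    obtain m where m: "m \<in> I" "\<And>i. i \<in> I \<Longrightarrow> size i \<le> size m"
      using Max_in[of "size ` I"] Max_ge[of "size ` I"] I
      by (metis (no_types, lifting) finite_imageI image_iff image_is_empty)
    \<comment> \<open>Every \<open>i\<close> with \<open>y \<in> F i\<close> is counted in the overlap function of the largest one.\<close>
    have "(\<Sum>i\<in>I. w i powr \<alpha>) = (\<Sum>i\<in>I. w i powr \<alpha> * indicator (U i) y)"
      by (intro sum.cong) (auto simp: I_def F_def)
    also have "\<dots> \<le> h m y" unfolding h_def
      using m J by (intro sum_mono2) (auto simp: I_def F_def J_def)
    also have "\<dots> \<le> T" using m(1) by (auto simp: I_def F_def)
    finally have le: "(\<Sum>i\<in>I. w i powr \<alpha>) \<le> T" .
    \<comment> \<open>Since each single term is at most \<open>T\<close> and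
      \<open>q \<ge> 1\<close>, the bound on the sum with exponent \<open>\<alpha>\<close> passes to
      exponent \<open>q * \<alpha>\<close>.\<close>
    have single: "w i powr \<alpha> \<le> T" if "i \<in> I" for i
      using member_le_sum[OF that, of "\<lambda>i. w i powr \<alpha>"] I le by auto
    have "(\<Sum>i\<in>S. w i powr (q * \<alpha>) * indicator (F i) y) = (\<Sum>i\<in>I. w i powr (q * \<alpha>))"
      unfolding I_def sum.inter_filter[OF S] by (intro sum.cong) auto
    also have "\<dots> \<le> (\<Sum>i\<in>I. T powr (q - 1) * w i powr \<alpha>)"
    proof (rule sum_mono)
      fix i assume i: "i \<in> I"
      have "w i powr (q * \<alpha>) = (w i powr \<alpha>) powr (q - 1) * w i powr \<alpha>"
        by (simp add: powr_powr algebra_simps flip: powr_add)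
      also have "\<dots> \<le> T powr (q - 1) * w i powr \<alpha>"
        using single[OF i] q by (intro mult_right_mono powr_mono2) auto
      finally show "w i powr (q * \<alpha>) \<le> T powr (q - 1) * w i powr \<alpha>" .
    qed
    also have "\<dots> \<le> T powr (q - 1) * T" unfolding sum_distrib_left[symmetric] using le by (intro mult_left_mono) auto
    also have "\<dots> = T powr q" using T by (simp add: powr_diff)
    finally show ?thesis .
  next
    case False
    then show ?thesis by (simp add: sum.neutral)
  qed
  have "ennreal W = (\<Sum>i\<in>S. ennreal (w i powr (q * \<alpha>)) * ennreal (w i powr (1 - q * \<alpha>)))"
    using pos wq by (simp add: W_def sum_ennreal less_imp_le flip: ennreal_mult)
  also have "\<dots> \<le> (\<Sum>i\<in>S. ennreal (w i powr (q * \<alpha>)) * (B * (\<integral>\<^sup>+y\<in>F i. g y \<partial>M)))"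
    using F half by (intro sum_mono mult_left_mono weak) (auto simp: F_def)
  also have "\<dots> = B * (\<Sum>i\<in>S. ennreal (w i powr (q * \<alpha>)) * (\<integral>\<^sup>+y\<in>F i. g y \<partial>M))"
    by (simp add: sum_distrib_left mult_ac)
  also have "(\<Sum>i\<in>S. ennreal (w i powr (q * \<alpha>)) * (\<integral>\<^sup>+y\<in>F i. g y \<partial>M)) 
      = (\<integral>\<^sup>+y. (\<Sum>i\<in>S. ennreal (w i powr (q * \<alpha>)) * (g y * indicator (F i) y)) \<partial>M)"
  proof -
    have m: "(\<lambda>y. g y * indicator (F i) y) \<in> borel_measurable M" if "i \<in> S" for i
    proof -
      note [measurable] = F[OF that]
      show ?thesis by measurable
    qed
    show ?thesis
      using m by (simp add: nn_integral_sum nn_integral_cmult)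
  qed
  also have "\<dots> \<le> (\<integral>\<^sup>+y. ennreal (T powr q) * g y \<partial>M)"
  proof (rule nn_integral_mono)
    fix y
    have "(\<Sum>i\<in>S. ennreal (w i powr (q * \<alpha>)) * (g y * indicator (F i) y)) = (\<Sum>i\<in>S. ennreal (w i powr (q * \<alpha>) * indicator (F i) y)) * g y"
      unfolding sum_distrib_right by (intro sum.cong) (auto split: split_indicator)
    also have "(\<Sum>i\<in>S. ennreal (w i powr (q * \<alpha>) * indicator (F i) y)) = ennreal (\<Sum>i\<in>S. w i powr (q * \<alpha>) * indicator (F i) y)"
      by (rule sum_ennreal) auto
    also have "\<dots> * g y \<le> ennreal (T powr q) * g y"
      using overlap[of y] by (intro mult_right_mono ennreal_leI) auto
    finally show "(\<Sum>i\<in>S. ennreal (w i powr (q * \<alpha>)) * (g y * indicator (F i) y)) \<le> ennreal (T powr q) * g y" .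
  qed
  also have "\<dots> = ennreal (T powr q) * (\<integral>\<^sup>+y. g y \<partial>M)" by (rule nn_integral_cmult) measurable
  finally have main: "ennreal W \<le> B * (ennreal (T powr q) * (\<integral>\<^sup>+y. g y \<partial>M))"
    by (simp add: mult_left_mono)
  \<comment> \<open>Dividing by the power of \<open>W\<close> contained in \<open>T powr q\<close>
    leaves only \<open>(4 * K) powr q\<close>.\<close>
  have "ennreal (W powr (1 - q * \<alpha>)) = ennreal (W powr (- (q * \<alpha>))) * ennreal W"
    using W by (simp add: powr_diff powr_minus field_simps flip: ennreal_mult)
  also have "\<dots> \<le> ennreal (W powr (- (q * \<alpha>))) * (B * (ennreal (T powr q) * (\<integral>\<^sup>+y. g y \<partial>M)))"
    using main by (rule mult_left_mono) simp
  also have "\<dots> = ennreal (W powr (- (q * \<alpha>)) * T powr q) * B * (\<integral>\<^sup>+y. g y \<partial>M)"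
    by (simp add: ennreal_mult mult_ac)
  also have "W powr (- (q * \<alpha>)) * T powr q = (4 * K) powr q"
    using W K by (simp add: T_def powr_mult powr_powr powr_minus mult_ac)
  finally show ?thesis unfolding W_def .
qed simp

section \<open>Geometry of parabolic rectangles\<close>

lemma cube_eq_cbox: "cube x L = cbox (\<chi> i. x $ i - L / 2) (\<chi> i. x $ i + L / 2)"
  by (simp only: cube_def set_eq_iff mem_Collect_eq mem_box_cart abs_diff_le_iff vec_lambda_beta) simp

lemma sets_lebesgue_cube_Times [measurable, simp]:
  fixes a b :: real
  shows "cube x L \<times> {a<..<b} \<in> sets lebesgue"
proof -
  have "cube x L \<times> {a<..<b} \<in> sets borel"
    unfolding cube_eq_cbox by (intro borel_Times) auto
  then show ?thesis by auto
qed

lemma emeasure_cube_Times: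
  fixes x :: "real ^ 'n"
  assumes "0 < L" "a \<le> b"
  shows "emeasure lebesgue (cube x L \<times> {a<..<b}) = ennreal (L ^ CARD('n) * (b - a))"
proof -
  have "emeasure lborel (cube x L) = ennreal (measure lborel (cube x L))"
    unfolding cube_eq_cbox by (intro emeasure_eq_ennreal_measure) (simp add: emeasure_lborel_cbox_eq)
  also have "measure lborel (cube x L) = L ^ CARD('n)"
    unfolding cube_eq_cbox using assms by (subst content_cbox_cart) (auto simp: interval_ne_empty_cart)
  finally have cube: "emeasure lborel (cube x L) = ennreal (L ^ CARD('n))" .
  have "emeasure lebesgue (cube x L \<times> {a<..<b}) = emeasure (lborel \<Otimes>\<^sub>M lborel) (cube x L \<times> {a<..<b})"
    unfolding lborel_prod cube_eq_cbox by (simp add: borel_Times)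
  also have "\<dots> = emeasure lborel (cube x L) * emeasure lborel {a<..<b}"
    by (rule lborel.emeasure_pair_measure_Times) (auto simp: cube_eq_cbox)
  finally show ?thesis using assms by (simp add: cube ennreal_mult)
qed

text \<open>
  In the next three definitions \<open>z\<close> is the centre of the lower part \<open>R\<^sup>-(\<gamma>)\<close>, not of the rectangle.
\<close>

definition upper_rect :: "real \<Rightarrow> real \<Rightarrow> (real ^ 'n) \<times> real \<Rightarrow> real \<Rightarrow> ((real ^ 'n) \<times> real) set" where
  "upper_rect p \<gamma> z L = upper_part p \<gamma> (fst z) (snd z + (1 + \<gamma>) / 2 * L powr p) L"

definition lower_rect :: "real \<Rightarrow> real \<Rightarrow> (real ^ 'n) \<times> real \<Rightarrow> real \<Rightarrow> ((real ^ 'n) \<times> real) set" where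
  "lower_rect p \<gamma> z L = lower_part p \<gamma> (fst z) (snd z + (1 + \<gamma>) / 2 * L powr p) L"

text \<open>The lower part shrunk by the factor \<open>3\<close> about its centre.\<close>

definition core :: "real \<Rightarrow> real \<Rightarrow> (real ^ 'n) \<times> real \<Rightarrow> real \<Rightarrow> ((real ^ 'n) \<times> real) set" where
  "core p \<gamma> z L = cube (fst z) (L / 3) \<times>
     {snd z - (1 - \<gamma>) / 6 * L powr p <..< snd z + (1 - \<gamma>) / 6 * L powr p}"

text \<open>The common measure of the upper and the lower part. The type argument supplies the
  dimension, which the real arguments do not determine.\<close>

definition rect_vol :: "'n itself \<Rightarrow> real \<Rightarrow> real \<Rightarrow> real \<Rightarrow> real" where
  "rect_vol _ p \<gamma> L = L ^ CARD('n) * ((1 - \<gamma>) * L powr p)"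

lemma lower_center_eq_iff:
  "lower_center p \<gamma> x t L = z \<longleftrightarrow> x = fst z \<and> t = snd z + (1 + \<gamma>) / 2 * L powr p"
  by (cases z) (auto simp: lower_center_def midpoint_def field_simps)

lemma rect_vol_pos: "0 < L \<Longrightarrow> \<gamma> < 1 \<Longrightarrow> 0 < rect_vol TYPE('n) p \<gamma> L"
  by (simp add: rect_vol_def)

lemma sets_rect [measurable, simp]:
  "upper_rect p \<gamma> z L \<in> sets lebesgue" "lower_rect p \<gamma> z L \<in> sets lebesgue" "core p \<gamma> z L \<in> sets lebesgue"
  by (simp_all add: upper_rect_def upper_part_def lower_rect_def lower_part_def core_def)

lemma emeasure_rect:
  fixes z :: "(real ^ 'n) \<times> real"
  assumes "0 < L" "\<gamma> < 1"
  shows "emeasure lebesgue (upper_rect p \<gamma> z L) = ennreal (rect_vol TYPE('n) p \<gamma> L)"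
    and "emeasure lebesgue (lower_rect p \<gamma> z L) = ennreal (rect_vol TYPE('n) p \<gamma> L)"
    and "emeasure lebesgue (core p \<gamma> z L) = ennreal (rect_vol TYPE('n) p \<gamma> L / 3 ^ (CARD('n) + 1))"
proof -
  have le: "\<gamma> * L powr p \<le> L powr p" "0 \<le> (1 - \<gamma>) * L powr p" using assms by (auto simp: mult_left_le_one_le mult_right_le_one_le)
  show "emeasure lebesgue (upper_rect p \<gamma> z L) = ennreal (rect_vol TYPE('n) p \<gamma> L)"
    unfolding upper_rect_def upper_part_def using assms le
    by (subst emeasure_cube_Times) (auto simp: rect_vol_def algebra_simps)
  show "emeasure lebesgue (lower_rect p \<gamma> z L) = ennreal (rect_vol TYPE('n) p \<gamma> L)"
    unfolding lower_rect_def lower_part_def using assms le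
    by (subst emeasure_cube_Times) (auto simp: rect_vol_def algebra_simps)
  show "emeasure lebesgue (core p \<gamma> z L) = ennreal (rect_vol TYPE('n) p \<gamma> L / 3 ^ (CARD('n) + 1))"
    unfolding core_def using assms le
    by (subst emeasure_cube_Times) (auto simp: rect_vol_def field_simps)
qed

lemma mem_lower_rect:
  "y \<in> lower_rect p \<gamma> z L \<longleftrightarrow> (\<forall>i. \<bar>fst y $ i - fst z $ i\<bar> \<le> L / 2) \<and> \<bar>snd y - snd z\<bar> < (1 - \<gamma>) / 2 * L powr p"
  unfolding abs_diff_less_iff by (cases y) (auto simp: lower_rect_def lower_part_def cube_def field_simps)

lemma mem_upper_rect:
  "y \<in> upper_rect p \<gamma> z L \<longleftrightarrow> (\<forall>i. \<bar>fst y $ i - fst z $ i\<bar> \<le> L / 2) \<and>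
     (1 + 3 * \<gamma>) / 2 * L powr p < snd y - snd z \<and> snd y - snd z < (3 + \<gamma>) / 2 * L powr p"
  by (cases y) (auto simp: upper_rect_def upper_part_def cube_def field_simps)

lemma mem_core:
  "y \<in> core p \<gamma> z L \<longleftrightarrow> (\<forall>i. \<bar>fst y $ i - fst z $ i\<bar> \<le> L / 6) \<and> \<bar>snd y - snd z\<bar> < (1 - \<gamma>) / 6 * L powr p"
  unfolding abs_diff_less_iff by (cases y) (auto simp: core_def cube_def field_simps)

text \<open>Makes the interiors of the cores an open cover of the level set, as the Lindelof
  property requires.\<close>

lemma center_in_interior_core:
  assumes "0 < L" "\<gamma> < 1"
  shows "z \<in> interior (core p \<gamma> z L)"
  unfolding core_def interior_Times cube_eq_cbox interior_cbox
  using assms by (cases z) (auto simp: mem_box_cart interior_open)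

text \<open>The Vitali enlargement: in space and in time, three radii of at most one sixth of the
  scale of the larger rectangle add up to one half.\<close>

lemma core_subset_lower_rect:
  assumes "0 < L" "L \<le> L'" "0 \<le> p" "\<gamma> < 1" "core p \<gamma> z L \<inter> core p \<gamma> z' L' \<noteq> {}"
  shows "core p \<gamma> z L \<subseteq> lower_rect p \<gamma> z' L'"
proof
  fix y assume y: "y \<in> core p \<gamma> z L"
  obtain s where s: "s \<in> core p \<gamma> z L" "s \<in> core p \<gamma> z' L'" using assms by auto
  have "(1 - \<gamma>) / 6 * L powr p \<le> (1 - \<gamma>) / 6 * L' powr p"
    using assms by (intro mult_left_mono powr_mono2) auto
  then have "\<bar>snd y - snd z'\<bar> < 3 * ((1 - \<gamma>) / 6 * L' powr p)"
    using y s unfolding mem_core by linarith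
  moreover have "\<bar>fst y $ i - fst z' $ i\<bar> \<le> L' / 2" for i
  proof -
    have "\<bar>fst y $ i - fst z $ i\<bar> \<le> L / 6" "\<bar>fst s $ i - fst z $ i\<bar> \<le> L / 6" "\<bar>fst s $ i - fst z' $ i\<bar> \<le> L' / 6"
      using y s unfolding mem_core by auto
    then show ?thesis using assms(2) by linarith
  qed
  ultimately show "y \<in> lower_rect p \<gamma> z' L'" unfolding mem_lower_rect by simp
qed

text \<open>A common point of the upper parts keeps the two lower centres close: each upper part
  lies at most \<open>2 * L' powr p\<close> later than its centre, and not earlier since
  \<open>0 \<le> \<gamma>\<close>. The core then adds at most \<open>L' powr p\<close> in time. In
  space the radii sum to \<open>7 / 6 * L'\<close>, below \<open>3 / 2 * L'\<close>.\<close>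

lemma core_subset_box:
  assumes "0 < L" "L \<le> L'" "0 \<le> p" "0 \<le> \<gamma>" "\<gamma> < 1" "upper_rect p \<gamma> z L \<inter> upper_rect p \<gamma> z' L' \<noteq> {}"
  shows "core p \<gamma> z L \<subseteq> cube (fst z') (3 * L') \<times> {snd z' - 3 * L' powr p <..< snd z' + 3 * L' powr p}"
proof
  fix y assume y: "y \<in> core p \<gamma> z L"
  obtain s where s: "s \<in> upper_rect p \<gamma> z L" "s \<in> upper_rect p \<gamma> z' L'" using assms by auto
  have le: "L powr p \<le> L' powr p" using assms by (intro powr_mono2) auto
  have *: "(1 - \<gamma>) / 6 * L powr p \<le> 1 * L powr p" "(3 + \<gamma>) / 2 * L powr p \<le> 2 * L powr p"
    "(3 + \<gamma>) / 2 * L' powr p \<le> 2 * L' powr p"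
    by (rule mult_right_mono; use assms in simp)+
  have **: "0 \<le> (1 + 3 * \<gamma>) / 2 * L powr p" "0 \<le> (1 + 3 * \<gamma>) / 2 * L' powr p"
    using assms by simp_all
  have "\<bar>snd y - snd z'\<bar> < 3 * L' powr p"
    using y s le * ** unfolding mem_core mem_upper_rect by linarith
  moreover have "\<bar>fst y $ i - fst z' $ i\<bar> \<le> 3 * L' / 2" for i
  proof -
    have "\<bar>fst y $ i - fst z $ i\<bar> \<le> L / 6" "\<bar>fst s $ i - fst z $ i\<bar> \<le> L / 2" "\<bar>fst s $ i - fst z' $ i\<bar> \<le> L' / 2"
      using y s unfolding mem_core mem_upper_rect by auto
    then show ?thesis using assms(1,2) by linarith
  qed
  ultimately show "y \<in> cube (fst z') (3 * L') \<times> {snd z' - 3 * L' powr p <..< snd z' + 3 * L' powr p}"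
    by (cases y) (auto simp: cube_def abs_less_iff)
qed

text \<open>Disjoint cores are packed into one box of volume \<open>(3 L')^n * 6 L'^p\<close>, with
  \<open>L' = L z'\<close>. Restoring the factor \<open>3^(n+1)\<close> lost in passing to the cores
  gives \<open>18 * 9^n\<close>; the division by \<open>1 - \<gamma>\<close> arises because the
  height of the box is not reduced by the time lag.\<close>

lemma sum_rect_vol_le:
  fixes S :: "((real ^ 'n) \<times> real) set"
  assumes "finite S" "\<And>z. z \<in> S \<Longrightarrow> 0 < L z" "z' \<in> S" "0 \<le> p" "0 \<le> \<gamma>" "\<gamma> < 1"
    and disj: "disjoint_family_on (\<lambda>z. core p \<gamma> z (L z)) S"
  shows "(\<Sum>z\<in>{z\<in>S. L z \<le> L z' \<and> upper_rect p \<gamma> z (L z) \<inter> upper_rect p \<gamma> z' (L z') \<noteq> {}}. rect_vol TYPE('n) p \<gamma> (L z))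
     \<le> 18 * 9 ^ CARD('n) / (1 - \<gamma>) * rect_vol TYPE('n) p \<gamma> (L z')"
proof -
  define J where "J = {z\<in>S. L z \<le> L z' \<and> upper_rect p \<gamma> z (L z) \<inter> upper_rect p \<gamma> z' (L z') \<noteq> {}}"
  have J: "finite J" "J \<subseteq> S" using assms by (auto simp: J_def)
  let ?v = "\<lambda>z. rect_vol TYPE('n) p \<gamma> (L z)"
  have v: "0 < ?v z" if "z \<in> S" for z using that assms by (intro rect_vol_pos) auto
  have "ennreal (sum ?v J / 3 ^ (CARD('n) + 1)) = (\<Sum>z\<in>J. emeasure lebesgue (core p \<gamma> z (L z)))"
  proof -
    have "(\<Sum>z\<in>J. emeasure lebesgue (core p \<gamma> z (L z))) = (\<Sum>z\<in>J. ennreal (?v z / 3 ^ (CARD('n) + 1)))"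
      using J assms by (intro sum.cong emeasure_rect) auto
    also have "\<dots> = ennreal (\<Sum>z\<in>J. ?v z / 3 ^ (CARD('n) + 1))"
      using J v by (intro sum_ennreal) (auto intro!: less_imp_le)
    finally show ?thesis by (simp add: sum_divide_distrib)
  qed
  also have "\<dots> = emeasure lebesgue (\<Union>z\<in>J. core p \<gamma> z (L z))"
    using J disj by (intro sum_emeasure) (auto intro: disjoint_family_on_mono)
  also have "\<dots> \<le> emeasure lebesgue (cube (fst z') (3 * L z') \<times> {snd z' - 3 * L z' powr p <..< snd z' + 3 * L z' powr p})"
  proof (rule emeasure_mono)
    show "(\<Union>z\<in>J. core p \<gamma> z (L z)) \<subseteq> cube (fst z') (3 * L z') \<times> {snd z' - 3 * L z' powr p <..< snd z' + 3 * L z' powr p}"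
      using assms(2-6) by (intro UN_least core_subset_box) (auto simp: J_def)
  qed simp
  also have "\<dots> = ennreal ((3 * L z') ^ CARD('n) * (6 * L z' powr p))"
    using assms by (subst emeasure_cube_Times) auto
  finally have "sum ?v J / 3 ^ (CARD('n) + 1) \<le> (3 * L z') ^ CARD('n) * (6 * L z' powr p)"
    using assms(2)[OF assms(3)] by (subst (asm) ennreal_le_iff) auto
  then have "sum ?v J \<le> 3 ^ (CARD('n) + 1) * ((3 * L z') ^ CARD('n) * (6 * L z' powr p))"
    by (simp add: field_simps)
  also have "\<dots> = 18 * (3 ^ CARD('n) * 3 ^ CARD('n)) / (1 - \<gamma>) * ?v z'"
    using assms by (simp add: rect_vol_def power_mult_distrib field_simps)
  also have "(3 ^ CARD('n) * 3 ^ CARD('n) :: real) = 9 ^ CARD('n)" by (simp flip: power_mult_distrib)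
  finally show ?thesis unfolding J_def .
qed

section \<open>The weight condition on a single rectangle\<close>

lemma epowr_simps [simp]:
  "epowr top a = top" "0 \<le> b \<Longrightarrow> epowr (ennreal b) a = ennreal (b powr a)"
  by (simp_all add: epowr_def)

lemma epowr_eq_0_iff: "epowr b a = 0 \<longleftrightarrow> b = 0"
  by (cases b rule: ennreal_cases) (auto simp: epowr_def)

text \<open>The supremum over all essential lower bounds is already that of a sequence, so only
  countably many null sets have to be united.\<close>

lemma AE_ess_inf_on_le: "AE z\<in>A in lebesgue. ess_inf_on A g \<le> g z"
proof -
  have "{c. AE z\<in>A in lebesgue. c \<le> g z} \<noteq> {}" by (auto intro!: exI[of _ 0])
  from ennreal_Sup_countable_SUP[OF this] obtain c where
    c: "range c \<subseteq> {c. AE z\<in>A in lebesgue. c \<le> g z}" "ess_inf_on A g = (SUP n::nat. c n)"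
    unfolding ess_inf_on_def by blast
  have "AE z\<in>A in lebesgue. c n \<le> g z" for n using c(1) by blast
  then have "AE z in lebesgue. \<forall>n. z \<in> A \<longrightarrow> c n \<le> g z"
    unfolding AE_all_countable by blast
  then show ?thesis unfolding c(2) by eventually_elim (auto intro: SUP_least)
qed

lemma emeasure_eq_0_if_AE_False:
  assumes "A \<in> sets M" "AE z\<in>A in M. False"
  shows "emeasure M A = 0"
proof -
  have "A \<in> null_sets M" using assms by (subst AE_iff_null_sets) auto
  then show ?thesis by auto
qed

text \<open>The values of \<open>v\<close> are finite, so an infinite essential infimum is possible
  on null sets only. Its inverse in \<open>A_const\<close> is therefore never 0.\<close>

lemma ess_inf_on_less_top:
  assumes "A \<in> sets lebesgue" "emeasure lebesgue A \<noteq> 0"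
  shows "ess_inf_on A (\<lambda>z. ennreal (v z)) < \<infinity>"
proof (rule ccontr)
  assume "\<not> ?thesis"
  then have "ess_inf_on A (\<lambda>z. ennreal (v z)) = \<infinity>" by (metis infinity_ennreal_def less_top)
  then have "AE z\<in>A in lebesgue. False"
    using AE_ess_inf_on_le[of A "\<lambda>z. ennreal (v z)"] by (simp add: top_unique)
  then show False using emeasure_eq_0_if_AE_False assms by blast
qed

lemma A_const_ge:
  assumes "0 < L"
  shows "q = 1 \<Longrightarrow> inverse (ess_inf_on (upper_rect p \<gamma> z L) (\<lambda>z. ennreal (v z)))
             * epowr (average (lower_rect p \<gamma> z L) (\<lambda>z. ennreal (w z powr r))) (1 / r) \<le> A_const p \<gamma> q r w v"
    and "q \<noteq> 1 \<Longrightarrow> epowr (average (lower_rect p \<gamma> z L) (\<lambda>z. ennreal (w z powr r))) (1 / r)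
             * epowr (average (upper_rect p \<gamma> z L) (\<lambda>z. epowr (inverse (ennreal (v z))) (q / (q - 1)))) (1 / (q / (q - 1)))
         \<le> A_const p \<gamma> q r w v"
  using assms unfolding A_const_def upper_rect_def lower_rect_def Let_def
  by (auto intro!: Sup_upper)

lemma emeasure_upper_rect_neq_0:
  fixes z :: "(real ^ 'n) \<times> real"
  assumes "0 < L" "\<gamma> < 1"
  shows "emeasure lebesgue (upper_rect p \<gamma> z L) \<noteq> 0"
proof -
  have "0 < ennreal (rect_vol TYPE('n) p \<gamma> L)" using rect_vol_pos[OF assms] by simp
  then show ?thesis using emeasure_rect(1)[OF assms, of p z] by (metis less_irrefl)
qed

text \<open>As \<open>v\<close> is finite, its negative power vanishes nowhere. This excludes a
  product \<open>\<infinity> * 0\<close> in \<open>A_const\<close>.\<close>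

lemma average_upper_rect_pos:
  fixes v :: "(real ^ 'n) \<times> real \<Rightarrow> real"
  assumes "0 < L" "\<gamma> < 1" "v \<in> borel_measurable lebesgue"
  shows "average (upper_rect p \<gamma> z L) (\<lambda>z. epowr (inverse (ennreal (v z))) a) \<noteq> 0"
proof
  let ?U = "upper_rect p \<gamma> z L"
  have [measurable]: "(\<lambda>z. epowr (inverse (ennreal (v z))) a) \<in> borel_measurable lebesgue"
    unfolding epowr_def using assms(3) by measurable
  assume "average ?U (\<lambda>z. epowr (inverse (ennreal (v z))) a) = 0"
  then have "(\<integral>\<^sup>+z\<in>?U. epowr (inverse (ennreal (v z))) a \<partial>lebesgue) = 0"
    using emeasure_rect(1)[OF assms(1,2), of p z] by (auto simp: average_def ennreal_divide_eq_0_iff)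
  then have "AE z in lebesgue. epowr (inverse (ennreal (v z))) a * indicator ?U z = 0"
    by (subst (asm) nn_integral_0_iff_AE) auto
  then have "AE z\<in>?U in lebesgue. False"
    by eventually_elim (auto simp: epowr_eq_0_iff)
  then have "emeasure lebesgue ?U = 0"
    by (intro emeasure_eq_0_if_AE_False) auto
  then show False using emeasure_upper_rect_neq_0 assms by blast
qed

text \<open>The factor of \<open>A_const\<close> that involves \<open>v\<close> is strictly
  positive, so an infinite mass of the lower part would make the constant infinite.\<close>

lemma lower_rect_weight_finite:
  fixes w v :: "(real ^ 'n) \<times> real \<Rightarrow> real"
  assumes "0 < L" "\<gamma> < 1" "v \<in> borel_measurable lebesgue" "A_const p \<gamma> q r w v < \<infinity>"
  shows "(\<integral>\<^sup>+z\<in>lower_rect p \<gamma> z L. ennreal (w z powr r) \<partial>lebesgue) < \<infinity>"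
proof (rule ccontr)
  assume "\<not> ?thesis"
  then have "(\<integral>\<^sup>+z\<in>lower_rect p \<gamma> z L. ennreal (w z powr r) \<partial>lebesgue) = \<infinity>"
    by (metis infinity_ennreal_def less_top)
  then have top: "epowr (average (lower_rect p \<gamma> z L) (\<lambda>z. ennreal (w z powr r))) (1 / r) = \<infinity>"
    by (simp add: average_def emeasure_rect(2)[OF assms(1,2)] ennreal_top_divide epowr_def)
  have "A_const p \<gamma> q r w v = \<infinity>"
  proof (cases "q = 1")
    case True
    have "ess_inf_on (upper_rect p \<gamma> z L) (\<lambda>z. ennreal (v z)) < \<infinity>"
      by (intro ess_inf_on_less_top sets_rect emeasure_upper_rect_neq_0 assms)
    then show ?thesis using A_const_ge(1)[OF assms(1) True, of p \<gamma> z v w r] top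
      by (auto simp: ennreal_mult_top top_unique split: if_splits)
  next
    case False
    let ?avg = "average (upper_rect p \<gamma> z L) (\<lambda>z. epowr (inverse (ennreal (v z))) (q / (q - 1)))"
    have "epowr ?avg (1 / (q / (q - 1))) \<noteq> 0"
      unfolding epowr_eq_0_iff by (rule average_upper_rect_pos[OF assms(1-3)])
    then have "\<infinity> * epowr ?avg (1 / (q / (q - 1))) = \<infinity>"
      unfolding infinity_ennreal_def by (subst ennreal_top_mult) (simp only: if_False)
    then show ?thesis using A_const_ge(2)[OF assms(1) False, of p \<gamma> z w r v]
      unfolding top by (simp only: infinity_ennreal_def top_unique)
  qed
  then show False using assms by simp
qed

text \<open>Hoelder's inequality is applied on \<open>F\<close> only, then the integral of the
  negative power of \<open>v\<close> is enlarged to the whole upper part, where the weight condition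
  controls it. Turning averages into integrals produces the power of \<open>\<kappa>\<close>:
  \<open>q / r\<close> from \<open>w\<close> and \<open>q - 1\<close> from \<open>v\<close>. For
  \<open>q = 1\<close> the essential lower bound of \<open>v\<close> replaces Hoelder's
  inequality.\<close>

lemma local_weak_type:
  fixes w v f :: "(real ^ 'n) \<times> real \<Rightarrow> real"
  assumes L: "0 < L" "\<gamma> < 1" and q: "1 \<le> q" and r: "0 < r"
    and weights: "weight w" "weight v" and [measurable]: "f \<in> borel_measurable lebesgue" and A: "A_const p \<gamma> q r w v < \<infinity>"
    and wi: "(\<integral>\<^sup>+z\<in>lower_rect p \<gamma> z L. ennreal (w z powr r) \<partial>lebesgue) = ennreal wi" "0 < wi"
    and F [measurable]: "F \<in> sets lebesgue" "F \<subseteq> upper_rect p \<gamma> z L"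
    and c: "0 \<le> c" "ennreal c \<le> (\<integral>\<^sup>+y\<in>F. ennreal \<bar>f y\<bar> \<partial>lebesgue)"
  defines "\<kappa> \<equiv> rect_vol TYPE('n) p \<gamma> L"
  shows "ennreal (c powr q * wi powr (q / r))
     \<le> ennreal (enn2real (A_const p \<gamma> q r w v) powr q * \<kappa> powr (q / r + q - 1)) * (\<integral>\<^sup>+y\<in>F. ennreal (\<bar>f y\<bar> powr q * v y powr q) \<partial>lebesgue)"
proof -
  have v[measurable]: "v \<in> borel_measurable lebesgue" and v0: "\<And>z. 0 \<le> v z" using weights unfolding weight_def by blast+
  have k: "0 < \<kappa>" unfolding \<kappa>_def using L by (rule rect_vol_pos)
  define X where "X = (\<integral>\<^sup>+y\<in>F. ennreal (\<bar>f y\<bar> powr q * v y powr q) \<partial>lebesgue)"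
  obtain a where a: "A_const p \<gamma> q r w v = ennreal a" "0 \<le> a" using A by (auto simp: less_top_ennreal)
  have avw: "epowr (average (lower_rect p \<gamma> z L) (\<lambda>z. ennreal (w z powr r))) (1 / r) = ennreal ((wi / \<kappa>) powr (1 / r))"
    using wi k by (simp add: average_def emeasure_rect(2)[OF L] divide_ennreal flip: \<kappa>_def)
  have wk: "0 < (wi / \<kappa>) powr (1 / r)" using wi k by simp
  have "ennreal (c powr q * wi powr (q / r)) \<le> ennreal (a powr q * \<kappa> powr (q / r + q - 1)) * X"
  proof (cases "q = 1")
    case True
    define m where "m = ess_inf_on (upper_rect p \<gamma> z L) (\<lambda>z. ennreal (v z))"
    have "m < \<infinity>" unfolding m_def
      by (intro ess_inf_on_less_top sets_rect emeasure_upper_rect_neq_0 L)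
    then obtain m' where m': "m = ennreal m'" "0 \<le> m'" by (auto simp: less_top_ennreal)
    have le: "inverse m * ennreal ((wi / \<kappa>) powr (1 / r)) \<le> ennreal a"
      using A_const_ge(1)[OF L(1) True, of p \<gamma> z v w r] unfolding avw a(1) m_def .
    \<comment> \<open>A zero essential infimum has inverse \<open>\<infinity>\<close>, which
      together with \<open>0 < wi\<close> contradicts the finiteness of the constant.\<close>
    have "m' \<noteq> 0"
    proof
      assume "m' = 0"
      with le m' wk show False by (simp add: ennreal_top_mult top_unique)
    qed
    with m' have m'0: "0 < m'" by simp
    have "(wi / \<kappa>) powr (1 / r) / m' \<le> a"
      using le m' m'0 a wk by (simp add: inverse_ennreal ennreal_le_iff divide_inverse mult.commute flip: ennreal_mult)
    then have b: "(wi / \<kappa>) powr (1 / r) \<le> a * m'" using m'0 by (simp add: divide_le_eq)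
    have "ennreal m' * ennreal c \<le> ennreal m' * (\<integral>\<^sup>+y\<in>F. ennreal \<bar>f y\<bar> \<partial>lebesgue)"
      by (rule mult_left_mono[OF c(2)]) simp
    also have "\<dots> = (\<integral>\<^sup>+y. ennreal m' * (ennreal \<bar>f y\<bar> * indicator F y) \<partial>lebesgue)"
      by (rule nn_integral_cmult[symmetric]) measurable
    also have "\<dots> \<le> X" unfolding X_def
    proof (rule nn_integral_mono_AE)
      show "AE y in lebesgue. ennreal m' * (ennreal \<bar>f y\<bar> * indicator F y) \<le> ennreal (\<bar>f y\<bar> powr q * v y powr q) * indicator F y"
        using AE_ess_inf_on_le[of "upper_rect p \<gamma> z L" "\<lambda>z. ennreal (v z)"]
      proof eventually_elim
        case (elim y)
        show ?case
        proof (cases "y \<in> F")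
          case True
          then have "m' \<le> v y" using elim F(2) m' v0 unfolding m_def[symmetric] by (auto simp: ennreal_le_iff)
          then have "m' * \<bar>f y\<bar> \<le> \<bar>f y\<bar> * v y" using mult_right_mono[of m' "v y" "\<bar>f y\<bar>"] by (simp add: mult.commute)
          moreover have "ennreal m' * ennreal \<bar>f y\<bar> = ennreal (m' * \<bar>f y\<bar>)"
            using m' by (intro ennreal_mult[symmetric]) auto
          ultimately show ?thesis using True \<open>q = 1\<close> v0[of y] by (simp add: ennreal_leI)
        qed simp
      qed
    qed
    finally have X: "ennreal (m' * c) \<le> X" using m' c by (simp add: ennreal_mult)
    have "c * (wi / \<kappa>) powr (1 / r) \<le> a * (m' * c)" using mult_left_mono[OF b c(1)] by (simp add: mult_ac)
    then have "c * wi powr (1 / r) \<le> a * \<kappa> powr (1 / r) * (m' * c)"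
      using k by (simp add: powr_divide field_simps)
    then have "ennreal (c * wi powr (1 / r)) \<le> ennreal (a * \<kappa> powr (1 / r)) * ennreal (m' * c)"
      using a m' c by (subst ennreal_mult[symmetric]) (auto intro: ennreal_leI)
    also have "\<dots> \<le> ennreal (a * \<kappa> powr (1 / r)) * X" using X by (rule mult_left_mono) simp
    finally show ?thesis using True c a by simp
  next
    case False
    then have q: "1 < q" using q by simp
    define q' where "q' = q / (q - 1)"
    have q': "0 < q'" "q / q' = q - 1" using q by (auto simp: q'_def)
    define Y where "Y = (\<integral>\<^sup>+y\<in>upper_rect p \<gamma> z L. epowr (inverse (ennreal (v y))) q' \<partial>lebesgue)"
    have avv: "average (upper_rect p \<gamma> z L) (\<lambda>z. epowr (inverse (ennreal (v z))) q') = Y / ennreal \<kappa>"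
      unfolding average_def emeasure_rect(1)[OF L] Y_def \<kappa>_def ..
    have le: "ennreal ((wi / \<kappa>) powr (1 / r)) * epowr (Y / ennreal \<kappa>) (1 / q') \<le> ennreal a"
      using A_const_ge(2)[OF L(1) False, of p \<gamma> z w r v]
      unfolding avw a(1) q'_def[symmetric] avv .
    have "Y \<noteq> \<infinity>"
    proof
      assume "Y = \<infinity>"
      then show False using le wk by (simp add: ennreal_top_divide ennreal_mult_top top_unique)
    qed
    then obtain y where y: "Y = ennreal y" "0 \<le> y" by (cases Y rule: ennreal_cases) auto
    have "y \<noteq> 0"
      using average_upper_rect_pos[OF L v, of p z q'] y unfolding average_def Y_def[symmetric] by auto
    with y have y0: "0 < y" by simp
    have "(wi / \<kappa>) powr (1 / r) * (y / \<kappa>) powr (1 / q') \<le> a"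
      using le y y0 k a by (simp add: divide_ennreal flip: ennreal_mult)
    then have "((wi / \<kappa>) powr (1 / r) * (y / \<kappa>) powr (1 / q')) powr q \<le> a powr q"
      using q by (intro powr_mono2) auto
    then have wy: "(wi / \<kappa>) powr (q / r) * (y / \<kappa>) powr (q - 1) \<le> a powr q"
      using q' by (simp add: powr_mult powr_powr)
    then have *: "wi powr (q / r) * y powr (q - 1) \<le> a powr q * \<kappa> powr (q / r + q - 1)"
    proof -
      have "\<kappa> powr (q / r + q - 1) = \<kappa> powr (q / r) * \<kappa> powr (q - 1)" by (simp add: add_diff_eq flip: powr_add)
      then show ?thesis using k wy by (simp add: powr_divide divide_le_eq mult_ac)
    qed
    have "(\<integral>\<^sup>+y\<in>F. epowr (inverse (ennreal (v y))) (q / (q - 1)) \<partial>lebesgue) \<le> ennreal y"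
      unfolding y(1)[symmetric] Y_def q'_def using F(2) by (intro nn_integral_mono) (auto split: split_indicator)
    from nn_integral_weighted_Holder[OF q _ v F(1) _ v0 this y0 c(1), of "\<lambda>z. \<bar>f z\<bar>"] c(2)
    have H: "ennreal (c powr q) \<le> ennreal (y powr (q - 1)) * X" unfolding X_def by simp
    have "ennreal (c powr q * wi powr (q / r)) = ennreal (wi powr (q / r)) * ennreal (c powr q)"
      by (simp add: ennreal_mult mult.commute)
    also have "\<dots> \<le> ennreal (wi powr (q / r)) * (ennreal (y powr (q - 1)) * X)"
      using H by (rule mult_left_mono) simp
    also have "\<dots> = ennreal (wi powr (q / r) * y powr (q - 1)) * X" by (simp add: ennreal_mult mult.assoc)
    also have "\<dots> \<le> ennreal (a powr q * \<kappa> powr (q / r + q - 1)) * X"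
      using * by (intro mult_right_mono ennreal_leI) auto
    finally show ?thesis .
  qed
  then show ?thesis using a by (simp add: X_def)
qed

section \<open>Locally integrable functions\<close>

lemma locally_integrable_measurable:
  assumes "locally_integrable f"
  shows "f \<in> borel_measurable lebesgue"
proof (rule borel_measurable_LIMSEQ_real)
  fix n :: nat
  have "f absolutely_integrable_on (cball 0 (real n))" using assms by (simp add: locally_integrable_def)
  then show "(\<lambda>z. indicator (cball 0 (real n)) z * f z) \<in> borel_measurable lebesgue"
    unfolding set_integrable_def by (auto dest: borel_measurable_integrable)
next
  fix z
  show "(\<lambda>n. indicator (cball 0 (real n)) z * f z) \<longlonglongrightarrow> f z"
  proof (rule tendsto_eventually)
    show "\<forall>\<^sub>F n in sequentially. indicator (cball 0 (real n)) z * f z = f z"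
      using eventually_ge_at_top[of "nat \<lceil>norm z\<rceil>"]
      by eventually_elim (auto simp: indicator_def)
  qed
qed

lemma locally_integrable_bounded:
  assumes "locally_integrable f" "bounded B"
  shows "(\<integral>\<^sup>+y\<in>B. ennreal \<bar>f y\<bar> \<partial>lebesgue) < \<infinity>"
proof -
  have "f absolutely_integrable_on (closure B)" using assms by (simp add: locally_integrable_def)
  then have "(\<integral>\<^sup>+y. ennreal (norm (indicator (closure B) y *\<^sub>R f y)) \<partial>lebesgue) < \<infinity>"
    unfolding set_integrable_def integrable_iff_bounded by simp
  moreover have "(\<integral>\<^sup>+y\<in>B. ennreal \<bar>f y\<bar> \<partial>lebesgue) \<le> (\<integral>\<^sup>+y. ennreal (norm (indicator (closure B) y *\<^sub>R f y)) \<partial>lebesgue)"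
    using closure_subset[of B] by (intro nn_integral_mono) (auto split: split_indicator)
  ultimately show ?thesis by (rule le_less_trans[rotated])
qed

lemma bounded_upper_rect: "bounded (upper_rect p \<gamma> z L)"
  unfolding upper_rect_def upper_part_def cube_eq_cbox
  by (rule bounded_Times[OF bounded_cbox bounded_box[where 'a = real, unfolded box_real(1)]])

section \<open>The weak-type bound on one dyadic level\<close>

definition overlap_const :: "'n itself \<Rightarrow> real \<Rightarrow> real" where
  "overlap_const _ \<gamma> = 18 * 9 ^ CARD('n) / (1 - \<gamma>)"

lemma overlap_const_ge_1: "0 \<le> \<gamma> \<Longrightarrow> \<gamma> < 1 \<Longrightarrow> 1 \<le> overlap_const TYPE('n) \<gamma>"
proof -
  assume "0 \<le> \<gamma>" "\<gamma> < 1"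
  moreover have "(1::real) \<le> 9 ^ CARD('n)" by (rule one_le_power) simp
  ultimately have "1 - \<gamma> \<le> 18 * 9 ^ CARD('n)" by linarith
  then show ?thesis using \<open>\<gamma> < 1\<close> by (simp add: overlap_const_def)
qed

text \<open>The last identity matches the exponent \<open>q / r\<close> of
  \<open>local_weak_type\<close> with the exponent \<open>1 - q * \<alpha>\<close> of
  \<open>sparse_family_weak_type\<close>.\<close>

lemma exponent_relations:
  fixes q r \<alpha> :: real
  assumes "1 \<le> q" "0 \<le> \<alpha>" "\<alpha> < 1 / q" "1 / q - 1 / r = \<alpha>"
  shows "0 < r" "1 \<le> r" "\<alpha> < 1" "q / r = 1 - q * \<alpha>"
proof -
  have "0 < 1 / r" using assms by linarith
  then show r: "0 < r" by simp
  have "1 / r \<le> 1 / q" using assms by linarith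
  then have "q \<le> r" using r assms by (simp add: field_simps)
  then show "1 \<le> r" using assms by simp
  have "1 / q \<le> 1" using assms by simp
  then show "\<alpha> < 1" using assms by linarith
  have "1 - q / r = q * (1 / q - 1 / r)" using assms(1) by (simp add: right_diff_distrib)
  also have "\<dots> = q * \<alpha>" using assms(4) by simp
  finally show "q / r = 1 - q * \<alpha>" by simp
qed

text \<open>Vitali selection gives disjoint cores whose lower parts cover all cores. Disjointness
  yields the sparseness of the upper parts, and \<open>local_weak_type\<close> yields the local
  estimates. The bound does not depend on the number of points in \<open>Z\<close>.\<close>

lemma weight_cores_le:
  fixes w v f :: "(real ^ 'n) \<times> real \<Rightarrow> real" and len :: "(real ^ 'n) \<times> real \<Rightarrow> real"
  assumes p: "1 \<le> p" and \<gamma>: "0 \<le> \<gamma>" "\<gamma> < 1"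
    and exps: "1 \<le> q" "0 \<le> \<alpha>" "\<alpha> < 1 / q" "1 / q - 1 / r = \<alpha>"
    and weights: "weight w" "weight v" and A: "A_const p \<gamma> q r w v < \<infinity>"
    and lam: "0 < lam" and f[measurable]: "f \<in> borel_measurable lebesgue"
    and Z: "finite Z" and len: "\<And>z. z \<in> Z \<Longrightarrow> 0 < len z"
    and lower: "\<And>z. z \<in> Z \<Longrightarrow> ennreal (lam * rect_vol TYPE('n) p \<gamma> (len z) powr (1 - \<alpha>))
        \<le> (\<integral>\<^sup>+y\<in>upper_rect p \<gamma> z (len z). ennreal \<bar>f y\<bar> \<partial>lebesgue)"
    and upper: "\<And>z. z \<in> Z \<Longrightarrow> (\<integral>\<^sup>+y\<in>upper_rect p \<gamma> z (len z). ennreal \<bar>f y\<bar> \<partial>lebesgue)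
        \<le> ennreal (2 * lam * rect_vol TYPE('n) p \<gamma> (len z) powr (1 - \<alpha>))"
  shows "emeasure (density lebesgue (\<lambda>z. ennreal (w z powr r))) (\<Union>z\<in>Z. core p \<gamma> z (len z))
     \<le> epowr (A_const p \<gamma> q r w v) r * ennreal ((8 * overlap_const TYPE('n) \<gamma>) powr r / lam powr r)
        * epowr (\<integral>\<^sup>+z. ennreal (\<bar>f z\<bar> powr q * v z powr q) \<partial>lebesgue) (r / q)"
proof -
  note r = exponent_relations[OF exps]
  define K where "K = overlap_const TYPE('n) \<gamma>"
  have K: "1 \<le> K" unfolding K_def using \<gamma> by (rule overlap_const_ge_1)
  define N where "N = density lebesgue (\<lambda>z. ennreal (w z powr r))"
  have w[measurable]: "w \<in> borel_measurable lebesgue" and v[measurable]: "v \<in> borel_measurable lebesgue"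
    using weights by (auto simp: weight_def)
  have setsN[simp]: "sets N = sets lebesgue" by (simp add: N_def)
  have N: "emeasure N B = (\<integral>\<^sup>+z\<in>B. ennreal (w z powr r) \<partial>lebesgue)" if "B \<in> sets lebesgue" for B
    unfolding N_def using that by (intro emeasure_density) measurable
  have "core p \<gamma> z (len z) \<noteq> {}" if "z \<in> Z" for z
    using center_in_interior_core[OF len[OF that] \<gamma>(2)] interior_subset by blast
  then have "\<exists>S\<subseteq>Z. disjoint_family_on (\<lambda>z. core p \<gamma> z (len z)) S \<and>
    (\<forall>z\<in>Z. \<exists>s\<in>S. len z \<le> len s \<and> core p \<gamma> z (len z) \<inter> core p \<gamma> s (len s) \<noteq> {})"
    by (rule finite_Vitali_selection[OF Z])
  then obtain S where S: "S \<subseteq> Z" "disjoint_family_on (\<lambda>z. core p \<gamma> z (len z)) S"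
    "\<forall>z\<in>Z. \<exists>s\<in>S. len z \<le> len s \<and> core p \<gamma> z (len z) \<inter> core p \<gamma> s (len s) \<noteq> {}"
    by (elim exE conjE)
  define m where "m z = enn2real (emeasure N (lower_rect p \<gamma> z (len z)))" for z
  have m: "emeasure N (lower_rect p \<gamma> z (len z)) = ennreal (m z)" if "z \<in> Z" for z
    using lower_rect_weight_finite[OF len[OF that] \<gamma>(2) v A, of z] unfolding m_def
    by (simp add: N)
  have fS: "finite S" using S(1) Z finite_subset by blast
  \<comment> \<open>The abstract estimate needs positive masses; rectangles of mass 0 contribute
    nothing to the sum.\<close>
  define S' where "S' = {z\<in>S. 0 < m z}"
  have S': "finite S'" "S' \<subseteq> Z" "disjoint_family_on (\<lambda>z. core p \<gamma> z (len z)) S'"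
    using S(1,2) fS by (auto simp: S'_def intro: disjoint_family_on_mono)
  define W where "W = sum m S'"
  have "emeasure N (\<Union>z\<in>Z. core p \<gamma> z (len z)) \<le> emeasure N (\<Union>z\<in>S. lower_rect p \<gamma> z (len z))"
  proof (rule emeasure_mono)
    show "(\<Union>z\<in>Z. core p \<gamma> z (len z)) \<subseteq> (\<Union>z\<in>S. lower_rect p \<gamma> z (len z))"
    proof (rule UN_least)
      fix z assume z: "z \<in> Z"
      then obtain s where s: "s \<in> S" "len z \<le> len s" "core p \<gamma> z (len z) \<inter> core p \<gamma> s (len s) \<noteq> {}" using S(3) by blast
      then have "core p \<gamma> z (len z) \<subseteq> lower_rect p \<gamma> s (len s)"
        using p \<gamma> len[OF z] by (intro core_subset_lower_rect) auto
      then show "core p \<gamma> z (len z) \<subseteq> (\<Union>z\<in>S. lower_rect p \<gamma> z (len z))" using s(1) by blast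
    qed
    show "(\<Union>z\<in>S. lower_rect p \<gamma> z (len z)) \<in> sets N"
      unfolding setsN using fS by (intro sets.finite_UN) auto
  qed
  also have "\<dots> \<le> (\<Sum>z\<in>S. emeasure N (lower_rect p \<gamma> z (len z)))"
    using fS by (intro emeasure_subadditive_finite) auto
  also have "\<dots> = (\<Sum>z\<in>S. ennreal (m z))" using S(1) m by (intro sum.cong) auto
  also have "\<dots> = ennreal (sum m S)" by (rule sum_ennreal) (simp add: m_def)
  also have "sum m S = W"
    unfolding W_def S'_def sum.inter_filter[OF fS] by (intro sum.cong) (auto simp: m_def less_le)
  finally have NW: "emeasure N (\<Union>z\<in>Z. core p \<gamma> z (len z)) \<le> ennreal W" .
  define X where "X = (\<integral>\<^sup>+z. ennreal (\<bar>f z\<bar> powr q * v z powr q) \<partial>lebesgue)"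
  define a where "a = enn2real (A_const p \<gamma> q r w v)"
  have a: "A_const p \<gamma> q r w v = ennreal a" "0 \<le> a" using A by (simp_all add: a_def)
  define D where "D = (8 * K * a / lam) powr q"
  have "ennreal (W powr (1 - q * \<alpha>)) \<le> ennreal ((4 * K) powr q) * ennreal (a powr q / (lam / 2) powr q) * X"
    unfolding W_def X_def
  proof (rule sparse_family_weak_type[where size = len and U = "\<lambda>z. upper_rect p \<gamma> z (len z)" and f = "\<lambda>y. ennreal \<bar>f y\<bar>" and lam = lam
        and \<kappa> = "\<lambda>z. rect_vol TYPE('n) p \<gamma> (len z)"])
    fix z assume "z \<in> S'"
    then have z: "z \<in> Z" "0 < m z" using S' by (auto simp: S'_def)
    show "0 < rect_vol TYPE('n) p \<gamma> (len z)" "0 < m z"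
      using rect_vol_pos[OF len[OF z(1)] \<gamma>(2)] z(2) by auto
    show "ennreal (lam * rect_vol TYPE('n) p \<gamma> (len z) powr (1 - \<alpha>)) \<le> (\<integral>\<^sup>+y\<in>upper_rect p \<gamma> z (len z). ennreal \<bar>f y\<bar> \<partial>lebesgue)"
      by (rule lower[OF z(1)])
    show "(\<integral>\<^sup>+y\<in>upper_rect p \<gamma> z (len z). ennreal \<bar>f y\<bar> \<partial>lebesgue) \<le> ennreal (2 * lam * rect_vol TYPE('n) p \<gamma> (len z) powr (1 - \<alpha>))"
      by (rule upper[OF z(1)])
    show "(\<Sum>j\<in>{j \<in> S'. len j \<le> len z \<and> upper_rect p \<gamma> j (len j) \<inter> upper_rect p \<gamma> z (len z) \<noteq> {}}. rect_vol TYPE('n) p \<gamma> (len j))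
         \<le> K * rect_vol TYPE('n) p \<gamma> (len z)"
      unfolding K_def overlap_const_def
      using p by (intro sum_rect_vol_le S' \<open>z \<in> S'\<close> \<gamma> len subsetD[OF S'(2)]) auto
  next
    fix z F assume "z \<in> S'" and F: "F \<in> sets lebesgue" "F \<subseteq> upper_rect p \<gamma> z (len z)"
      and c: "ennreal (lam / 2 * rect_vol TYPE('n) p \<gamma> (len z) powr (1 - \<alpha>)) \<le> (\<integral>\<^sup>+y\<in>F. ennreal \<bar>f y\<bar> \<partial>lebesgue)"
    then have z: "z \<in> Z" "0 < m z" using S' by (auto simp: S'_def)
    define \<kappa> where "\<kappa> = rect_vol TYPE('n) p \<gamma> (len z)"
    have k: "0 < \<kappa>" unfolding \<kappa>_def by (rule rect_vol_pos[OF len[OF z(1)] \<gamma>(2)])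
    define e where "e = (1 - \<alpha>) * q"
    \<comment> \<open>The volume thus has the same exponent on both sides of the local estimate and
      cancels.\<close>
    have e: "q / r + q - 1 = e" using r(4) by (simp add: e_def algebra_simps)
    define D where "D = (lam / 2) powr q * \<kappa> powr e"
    have D: "0 < D" using lam k by (simp add: D_def)
    have "ennreal ((lam / 2 * \<kappa> powr (1 - \<alpha>)) powr q * m z powr (q / r))
      \<le> ennreal (a powr q * \<kappa> powr (q / r + q - 1)) * (\<integral>\<^sup>+y\<in>F. ennreal (\<bar>f y\<bar> powr q * v y powr q) \<partial>lebesgue)"
      unfolding \<kappa>_def a_def
      using m[OF z(1)] lam
      by (intro local_weak_type[OF len[OF z(1)] \<gamma>(2) exps(1) r(1) weights f A _ z(2) F _ c]) (simp_all add: N)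
    also have "(lam / 2 * \<kappa> powr (1 - \<alpha>)) powr q = D" unfolding D_def e_def powr_mult powr_powr ..
    finally have H: "ennreal (D * m z powr (q / r)) \<le> ennreal (a powr q * \<kappa> powr e) * (\<integral>\<^sup>+y\<in>F. ennreal (\<bar>f y\<bar> powr q * v y powr q) \<partial>lebesgue)"
      unfolding e .
    have "ennreal (m z powr (1 - q * \<alpha>)) = ennreal (1 / D) * ennreal (D * m z powr (q / r))"
      using D r(4) by (simp flip: ennreal_mult)
    also have "\<dots> \<le> ennreal (1 / D) * (ennreal (a powr q * \<kappa> powr e) * (\<integral>\<^sup>+y\<in>F. ennreal (\<bar>f y\<bar> powr q * v y powr q) \<partial>lebesgue))"
      using H by (rule mult_left_mono) simp
    also have "\<dots> = (ennreal (1 / D) * ennreal (a powr q * \<kappa> powr e)) * (\<integral>\<^sup>+y\<in>F. ennreal (\<bar>f y\<bar> powr q * v y powr q) \<partial>lebesgue)"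
      by (simp only: mult.assoc)
    also have "ennreal (1 / D) * ennreal (a powr q * \<kappa> powr e) = ennreal (1 / D * (a powr q * \<kappa> powr e))"
      using D by (intro ennreal_mult[symmetric]) auto
    also have "1 / D * (a powr q * \<kappa> powr e) = a powr q / (lam / 2) powr q"
      using k lam by (simp add: D_def)
    finally show "ennreal (m z powr (1 - q * \<alpha>)) \<le> ennreal (a powr q / (lam / 2) powr q) * (\<integral>\<^sup>+y\<in>F. ennreal (\<bar>f y\<bar> powr q * v y powr q) \<partial>lebesgue)" .
  qed (use S' r exps lam K in auto)
  also have "ennreal ((4 * K) powr q) * ennreal (a powr q / (lam / 2) powr q) = ennreal ((4 * K) powr q * (a powr q / (lam / 2) powr q))"
    by (intro ennreal_mult[symmetric]) auto
  also have "(4 * K) powr q * (a powr q / (lam / 2) powr q) = (4 * K * (a / (lam / 2))) powr q"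
    by (simp only: powr_mult powr_divide)
  \<comment> \<open>The 8 is the 4 of the overlap bound times the 2 lost by keeping only half of the
    mass.\<close>
  also have "4 * K * (a / (lam / 2)) = 8 * K * a / lam" by simp
  finally have main: "ennreal (W powr (q / r)) \<le> ennreal D * X" unfolding r(4) D_def .
  have "ennreal W \<le> ennreal ((8 * K * a / lam) powr r) * epowr X (r / q)"
  proof (cases "W = 0")
    case False
    have W: "0 < W" using False by (auto simp: W_def m_def less_le intro!: sum_nonneg)
    \<comment> \<open>For infinite \<open>X\<close> a zero constant would turn the right-hand side
      into \<open>0 * \<infinity> = 0\<close>; but it would also force \<open>W = 0\<close>.\<close>
    have a0: "0 < a"
    proof (rule ccontr)
      assume "\<not> 0 < a"
      then have "D = 0" using a by (simp add: D_def)
      then show False using main W by simp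
    qed
    show ?thesis
    proof (cases X rule: ennreal_cases)
      case (real x)
      have "W powr (q / r) \<le> D * x"
        using main real by (simp add: D_def ennreal_le_iff flip: ennreal_mult)
      then have "(W powr (q / r)) powr (r / q) \<le> (D * x) powr (r / q)"
        using r exps by (intro powr_mono2) auto
      moreover have "q / r * (r / q) = 1" "q * (r / q) = r" using r(1) exps(1) by simp_all
      then have "(W powr (q / r)) powr (r / q) = W" "D powr (r / q) = (8 * K * a / lam) powr r"
        using W unfolding D_def powr_powr by simp_all
      ultimately have "W \<le> (8 * K * a / lam) powr r * x powr (r / q)" by (simp only: powr_mult)
      then show ?thesis using real by (simp add: ennreal_leI flip: ennreal_mult)
    next
      case top
      then show ?thesis using a0 K lam by (simp add: ennreal_mult_top)
    qed
  qed simp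
  also have "ennreal ((8 * K * a / lam) powr r) = ennreal (a powr r * ((8 * K) powr r / lam powr r))"
    by (simp add: powr_mult powr_divide mult_ac)
  also have "\<dots> = epowr (A_const p \<gamma> q r w v) r * ennreal ((8 * K) powr r / lam powr r)"
    unfolding a(1) epowr_simps(2)[OF a(2)] by (rule ennreal_mult) simp_all
  finally show ?thesis using NW unfolding N_def K_def X_def by (rule order_trans[rotated])
qed

text \<open>The Lindelof property leaves countably many cores covering \<open>E\<close>, and
  continuity from below carries over the bound for finite unions. As \<open>E\<close> is an
  arbitrary set, the measure of a measurable superset is estimated.\<close>

lemma weight_level_set_le:
  fixes w v f :: "(real ^ 'n) \<times> real \<Rightarrow> real" and len :: "(real ^ 'n) \<times> real \<Rightarrow> real"
  assumes p: "1 \<le> p" and \<gamma>: "0 \<le> \<gamma>" "\<gamma> < 1"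
    and exps: "1 \<le> q" "0 \<le> \<alpha>" "\<alpha> < 1 / q" "1 / q - 1 / r = \<alpha>"
    and weights: "weight w" "weight v" and A: "A_const p \<gamma> q r w v < \<infinity>"
    and lam: "0 < lam" and f[measurable]: "f \<in> borel_measurable lebesgue"
    and len: "\<And>z. z \<in> E \<Longrightarrow> 0 < len z"
    and lower: "\<And>z. z \<in> E \<Longrightarrow> ennreal (lam * rect_vol TYPE('n) p \<gamma> (len z) powr (1 - \<alpha>))
        \<le> (\<integral>\<^sup>+y\<in>upper_rect p \<gamma> z (len z). ennreal \<bar>f y\<bar> \<partial>lebesgue)"
    and upper: "\<And>z. z \<in> E \<Longrightarrow> (\<integral>\<^sup>+y\<in>upper_rect p \<gamma> z (len z). ennreal \<bar>f y\<bar> \<partial>lebesgue)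
        \<le> ennreal (2 * lam * rect_vol TYPE('n) p \<gamma> (len z) powr (1 - \<alpha>))"
  shows "\<exists>U\<in>sets lebesgue. E \<subseteq> U \<and> emeasure (density lebesgue (\<lambda>z. ennreal (w z powr r))) U
     \<le> epowr (A_const p \<gamma> q r w v) r * ennreal ((8 * overlap_const TYPE('n) \<gamma>) powr r / lam powr r)
        * epowr (\<integral>\<^sup>+z. ennreal (\<bar>f z\<bar> powr q * v z powr q) \<partial>lebesgue) (r / q)"
    (is "\<exists>U\<in>_. _ \<and> emeasure ?N U \<le> ?B")
proof (cases "E = {}")
  case False
  have in_core: "z \<in> interior (core p \<gamma> z (len z))" if "z \<in> E" for z
    using len[OF that] \<gamma> by (intro center_in_interior_core)
  obtain \<F> where \<F>: "\<F> \<subseteq> (\<lambda>z. interior (core p \<gamma> z (len z))) ` E" "countable \<F>"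
    "\<Union>\<F> = (\<Union>z\<in>E. interior (core p \<gamma> z (len z)))"
    using Lindelof[of "(\<lambda>z. interior (core p \<gamma> z (len z))) ` E"] by auto
  obtain Z where Z: "Z \<subseteq> E" "countable Z" "\<F> = (\<lambda>z. interior (core p \<gamma> z (len z))) ` Z"
    using countable_subset_image[of \<F> "\<lambda>z. interior (core p \<gamma> z (len z))" E] \<F>(1,2) by blast
  have "Z \<noteq> {}" using False \<F>(3) Z(3) in_core by auto
  define x where "x = from_nat_into Z"
  have x: "range x = Z" unfolding x_def using \<open>Z \<noteq> {}\<close> Z(2) by (rule range_from_nat_into)
  define V where "V n = (\<Union>z\<in>x ` {..n}. core p \<gamma> z (len z))" for n
  have V: "V n \<in> sets lebesgue" for n unfolding V_def by (intro sets.finite_UN) auto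
  have "incseq V" unfolding V_def by (intro incseq_SucI UN_mono image_mono) auto
  have "E \<subseteq> \<Union>\<F>" unfolding \<F>(3) using in_core by blast
  also have "\<dots> \<subseteq> (\<Union>z\<in>Z. core p \<gamma> z (len z))" unfolding Z(3) using interior_subset by blast
  also have "\<dots> \<subseteq> (\<Union>n. V n)" unfolding x[symmetric] V_def by auto
  finally have "E \<subseteq> (\<Union>n. V n)" .
  moreover have "emeasure ?N (\<Union>n. V n) \<le> ?B"
  proof -
    have "emeasure ?N (\<Union>n. V n) = (SUP n. emeasure ?N (V n))"
      using V \<open>incseq V\<close> by (intro SUP_emeasure_incseq[symmetric]) auto
    also have "\<dots> \<le> ?B"
    proof (rule SUP_least)
      fix n
      have sub: "x ` {..n} \<subseteq> E" using x Z(1) by blast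
      show "emeasure ?N (V n) \<le> ?B" unfolding V_def
      proof (rule weight_cores_le[OF p \<gamma> exps weights A lam f])
        fix z assume "z \<in> x ` {..n}"
        then have "z \<in> E" using sub by blast
        then show "0 < len z"
          "ennreal (lam * rect_vol TYPE('n) p \<gamma> (len z) powr (1 - \<alpha>)) \<le> (\<integral>\<^sup>+y\<in>upper_rect p \<gamma> z (len z). ennreal \<bar>f y\<bar> \<partial>lebesgue)"
          "(\<integral>\<^sup>+y\<in>upper_rect p \<gamma> z (len z). ennreal \<bar>f y\<bar> \<partial>lebesgue) \<le> ennreal (2 * lam * rect_vol TYPE('n) p \<gamma> (len z) powr (1 - \<alpha>))"
          by (fact len lower upper)+
      qed simp
    qed
    finally show ?thesis .
  qed
  moreover have "(\<Union>n. V n) \<in> sets lebesgue" using V by blast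
  ultimately show ?thesis by blast
qed (auto intro!: bexI[of _ "{}"])

section \<open>Dyadic decomposition of the level set\<close>

lemma ex_dyadic_level:
  fixes x :: real
  assumes "1 \<le> x"
  shows "\<exists>k. 2 ^ k \<le> x \<and> x \<le> 2 * 2 ^ k"
proof -
  have "1 \<le> nat \<lfloor>x\<rfloor>" using assms by linarith
  then obtain k where k: "2 ^ k \<le> nat \<lfloor>x\<rfloor>" "nat \<lfloor>x\<rfloor> < 2 ^ (k + 1)"
    using ex_power_ivl1[of 2 "nat \<lfloor>x\<rfloor>"] by auto
  \<comment> \<open>The strict inequality between natural numbers gives the \<open>+ 1\<close> that
    absorbs the fractional part of \<open>x\<close>.\<close>
  have "real (2 ^ k) \<le> real (nat \<lfloor>x\<rfloor>)" "real (nat \<lfloor>x\<rfloor>) + 1 \<le> real (2 ^ (k + 1))"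
    using k by linarith+
  then have "real (2 ^ k) \<le> x" "x \<le> real (2 ^ (k + 1))" using assms by linarith+
  then show ?thesis by (intro exI[of _ k]) simp
qed

text \<open>A supremum above \<open>lam\<close> has a witness \<open>L\<close>, and clearing the
  volume turns the fractional average into an integral compared with
  \<open>lam * \<kappa> powr (1 - \<alpha>)\<close>. Local integrability makes this integral finite,
  so a dyadic level \<open>k\<close> exists.\<close>

lemma maximal_fun_greaterD:
  fixes f :: "(real ^ 'n) \<times> real \<Rightarrow> real"
  assumes "\<gamma> < 1" "0 < lam" "locally_integrable f" "ennreal lam < maximal_fun p \<gamma> \<alpha> f z"
  shows "\<exists>L k. 0 < L \<and>
     ennreal (2 ^ k * lam * rect_vol TYPE('n) p \<gamma> L powr (1 - \<alpha>)) \<le> (\<integral>\<^sup>+y\<in>upper_rect p \<gamma> z L. ennreal \<bar>f y\<bar> \<partial>lebesgue) \<and>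
     (\<integral>\<^sup>+y\<in>upper_rect p \<gamma> z L. ennreal \<bar>f y\<bar> \<partial>lebesgue) \<le> ennreal (2 * (2 ^ k * lam) * rect_vol TYPE('n) p \<gamma> L powr (1 - \<alpha>))"
proof -
  obtain L where L: "0 < L" and gt: "ennreal lam < ennreal (measure lebesgue (upper_rect p \<gamma> z L) powr \<alpha>)
           * average (upper_rect p \<gamma> z L) (\<lambda>y. ennreal \<bar>f y\<bar>)"
    using assms(4) unfolding maximal_fun_def less_Sup_iff upper_rect_def
    by (auto simp: lower_center_eq_iff)
  define \<kappa> where "\<kappa> = rect_vol TYPE('n) p \<gamma> L"
  have k: "0 < \<kappa>" unfolding \<kappa>_def using L assms(1) by (rule rect_vol_pos)
  have meas: "measure lebesgue (upper_rect p \<gamma> z L) = \<kappa>"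
    using k emeasure_rect(1)[OF L assms(1), of p z] unfolding measure_def \<kappa>_def by (metis enn2real_ennreal less_imp_le)
  obtain i where i: "(\<integral>\<^sup>+y\<in>upper_rect p \<gamma> z L. ennreal \<bar>f y\<bar> \<partial>lebesgue) = ennreal i" "0 \<le> i"
    using locally_integrable_bounded[OF assms(3) bounded_upper_rect, of p \<gamma> z L] by (auto simp: less_top_ennreal)
  have "average (upper_rect p \<gamma> z L) (\<lambda>y. ennreal \<bar>f y\<bar>) = ennreal (i / \<kappa>)"
    unfolding average_def i emeasure_rect(1)[OF L assms(1)] using i k by (simp add: divide_ennreal flip: \<kappa>_def)
  then have "ennreal lam < ennreal (\<kappa> powr \<alpha> * (i / \<kappa>))"
    using gt k i unfolding meas by (subst ennreal_mult) auto
  then have "lam < \<kappa> powr \<alpha> * (i / \<kappa>)" using assms(2) by (simp add: ennreal_less_iff)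
  then have lt: "lam * \<kappa> powr (1 - \<alpha>) < i"
    using k by (simp add: powr_diff field_simps)
  have pos: "0 < lam * \<kappa> powr (1 - \<alpha>)" using assms k by simp
  then obtain j where j: "2 ^ j \<le> i / (lam * \<kappa> powr (1 - \<alpha>))" "i / (lam * \<kappa> powr (1 - \<alpha>)) \<le> 2 * 2 ^ j"
    using ex_dyadic_level[of "i / (lam * \<kappa> powr (1 - \<alpha>))"] lt by (auto simp: le_divide_eq)
  then have "2 ^ j * lam * \<kappa> powr (1 - \<alpha>) \<le> i" "i \<le> 2 * (2 ^ j * lam) * \<kappa> powr (1 - \<alpha>)"
    using pos by (simp_all add: le_divide_eq divide_le_eq mult_ac)
  then show ?thesis using L i unfolding \<kappa>_def by (intro exI[of _ L] exI[of _ j]) (auto intro: ennreal_leI)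
qed

theorem theorem1p1:
  fixes p \<gamma> q \<alpha> r :: real
  assumes "1 \<le> p" "0 \<le> \<gamma>" "\<gamma> < 1" "1 \<le> q" "0 \<le> \<alpha>" "\<alpha> < 1 / q" "1 / q - 1 / r = \<alpha>"
  shows "\<exists>C::real. 0 < C \<and>
    (\<forall>w v :: (real ^ 'n) \<times> real \<Rightarrow> real.
      weight w \<longrightarrow> weight v \<longrightarrow> A_const p \<gamma> q r w v < \<infinity> \<longrightarrow>
      (\<forall>lam::real. \<forall>f :: (real ^ 'n) \<times> real \<Rightarrow> real.
        0 < lam \<longrightarrow> locally_integrable f \<longrightarrow>
        (\<integral>\<^sup>+z\<in>{z. maximal_fun p \<gamma> \<alpha> f z > ennreal lam}. ennreal (w z powr r) \<partial>lebesgue)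
          \<le> epowr (A_const p \<gamma> q r w v) r * ennreal (C / lam powr r)
              * epowr (\<integral>\<^sup>+z. ennreal (\<bar>f z\<bar> powr q * v z powr q) \<partial>lebesgue) (r / q)))"
proof -
  define C\<^sub>0 where "C\<^sub>0 = (8 * overlap_const TYPE('n) \<gamma>) powr r"
  have C\<^sub>0: "0 < C\<^sub>0" using overlap_const_ge_1[OF assms(2,3), where 'n = 'n] by (simp add: C\<^sub>0_def)
  have r: "1 \<le> r" using exponent_relations assms by blast
  show ?thesis
  \<comment> \<open>\<open>C\<^sub>0\<close> serves each dyadic level; the 2 is the sum of the
    geometric series over the levels.\<close>
  proof (intro exI[of _ "2 * C\<^sub>0"] conjI allI impI)
    fix w v f :: "(real ^ 'n) \<times> real \<Rightarrow> real" and lam :: real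
    assume weights: "weight w" "weight v" and A: "A_const p \<gamma> q r w v < \<infinity>"
      and lam: "0 < lam" and f: "locally_integrable f"
    note fm = locally_integrable_measurable[OF f]
    have w[measurable]: "w \<in> borel_measurable lebesgue" using weights by (simp add: weight_def)
    define N where "N = density lebesgue (\<lambda>z. ennreal (w z powr r))"
    define P where "P = epowr (A_const p \<gamma> q r w v) r"
    define X where "X = epowr (\<integral>\<^sup>+z. ennreal (\<bar>f z\<bar> powr q * v z powr q) \<partial>lebesgue) (r / q)"
    define E where "E = {z. maximal_fun p \<gamma> \<alpha> f z > ennreal lam}"
    define good where "good z L k \<longleftrightarrow> 0 < L \<and>
       ennreal (2 ^ k * lam * rect_vol TYPE('n) p \<gamma> L powr (1 - \<alpha>)) \<le> (\<integral>\<^sup>+y\<in>upper_rect p \<gamma> z L. ennreal \<bar>f y\<bar> \<partial>lebesgue) \<and>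
       (\<integral>\<^sup>+y\<in>upper_rect p \<gamma> z L. ennreal \<bar>f y\<bar> \<partial>lebesgue) \<le> ennreal (2 * (2 ^ k * lam) * rect_vol TYPE('n) p \<gamma> L powr (1 - \<alpha>))"
      for z :: "(real ^ 'n) \<times> real" and L :: real and k :: nat
    have "\<forall>z\<in>E. \<exists>L k. good z L k"
      using maximal_fun_greaterD[OF assms(3) lam f] unfolding E_def good_def by blast
    then obtain len k where good: "\<And>z. z \<in> E \<Longrightarrow> good z (len z) (k z)" by metis
    have level: "\<exists>U\<in>sets lebesgue. {z\<in>E. k z = j} \<subseteq> U \<and> emeasure N U \<le> P * ennreal (C\<^sub>0 / (2 ^ j * lam) powr r) * X" for j
      unfolding N_def P_def X_def C\<^sub>0_def
    proof (rule weight_level_set_le[where len = len, OF assms weights A _ fm])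
      fix z assume "z \<in> {z\<in>E. k z = j}"
      then have z: "z \<in> E" "k z = j" by auto
      have g: "good z (len z) j" using good[OF z(1)] unfolding z(2) .
      show "0 < len z" using g by (simp add: good_def)
      show "ennreal (2 ^ j * lam * rect_vol TYPE('n) p \<gamma> (len z) powr (1 - \<alpha>)) \<le> (\<integral>\<^sup>+y\<in>upper_rect p \<gamma> z (len z). ennreal \<bar>f y\<bar> \<partial>lebesgue)"
        using g by (simp add: good_def)
      show "(\<integral>\<^sup>+y\<in>upper_rect p \<gamma> z (len z). ennreal \<bar>f y\<bar> \<partial>lebesgue) \<le> ennreal (2 * (2 ^ j * lam) * rect_vol TYPE('n) p \<gamma> (len z) powr (1 - \<alpha>))"
        using g by (simp add: good_def)
    qed (use lam in simp)
    have "\<exists>U. \<forall>j. U j \<in> sets lebesgue \<and> {z\<in>E. k z = j} \<subseteq> U j \<and> emeasure N (U j) \<le> P * ennreal (C\<^sub>0 / (2 ^ j * lam) powr r) * X"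
      by (rule choice) (use level in \<open>simp add: Bex_def\<close>)
    then obtain U where U: "\<And>j. U j \<in> sets lebesgue" "\<And>j. {z\<in>E. k z = j} \<subseteq> U j"
      "\<And>j. emeasure N (U j) \<le> P * ennreal (C\<^sub>0 / (2 ^ j * lam) powr r) * X" by blast
    have EU: "E \<subseteq> (\<Union>j. U j)" using U(2) by blast
    \<comment> \<open>Since \<open>r \<ge> 1\<close>, the factor \<open>(2 ^ j) powr r\<close> is at
      least \<open>2 ^ j\<close>, which gives a geometric series of ratio 1/2 whatever
      \<open>r\<close> is.\<close>
    have decay: "C\<^sub>0 / (2 ^ j * lam) powr r \<le> C\<^sub>0 / lam powr r * (1 / 2) ^ j" for j :: nat
    proof -
      have "(2::real) ^ j = (2 ^ j) powr 1" by simp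
      also have "\<dots> \<le> (2 ^ j) powr r" using r by (intro powr_mono) auto
      finally have "C\<^sub>0 / ((2 ^ j) powr r * lam powr r) \<le> C\<^sub>0 / (2 ^ j * lam powr r)"
        using lam C\<^sub>0 by (intro divide_left_mono mult_right_mono) auto
      then show ?thesis by (simp add: powr_mult power_one_over mult.commute)
    qed
    \<comment> \<open>The nonnegative integral is monotone for arbitrary functions, so
      \<open>E\<close>, whose measurability has not been established, can be replaced by the
      measurable union.\<close>
    have "(\<integral>\<^sup>+z\<in>E. ennreal (w z powr r) \<partial>lebesgue) \<le> (\<integral>\<^sup>+z\<in>(\<Union>j. U j). ennreal (w z powr r) \<partial>lebesgue)"
      using EU by (intro nn_integral_mono) (auto split: split_indicator)
    also have "\<dots> = emeasure N (\<Union>j. U j)"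
      unfolding N_def using U(1) by (intro emeasure_density[symmetric]) auto
    also have "\<dots> \<le> (\<Sum>j. emeasure N (U j))"
      using U(1) by (intro emeasure_subadditive_countably) (auto simp: N_def)
    also have "\<dots> \<le> (\<Sum>j. P * ennreal (C\<^sub>0 / lam powr r * (1 / 2) ^ j) * X)"
    proof (intro suminf_le)
      fix j
      show "emeasure N (U j) \<le> P * ennreal (C\<^sub>0 / lam powr r * (1 / 2) ^ j) * X"
        by (rule order_trans[OF U(3)]) (intro mult_right_mono mult_left_mono ennreal_leI decay; simp)
    qed auto
    also have "\<dots> = P * (\<Sum>j. ennreal (C\<^sub>0 / lam powr r * (1 / 2) ^ j)) * X" by simp
    also have "(\<Sum>j. ennreal (C\<^sub>0 / lam powr r * (1 / 2) ^ j)) = ennreal (C\<^sub>0 / lam powr r * 2)"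
      using C\<^sub>0 sums_mult[OF geometric_sums[of "1 / 2 :: real"], of "C\<^sub>0 / lam powr r"]
      by (intro suminf_ennreal_eq) auto
    finally show "(\<integral>\<^sup>+z\<in>{z. maximal_fun p \<gamma> \<alpha> f z > ennreal lam}. ennreal (w z powr r) \<partial>lebesgue)
          \<le> epowr (A_const p \<gamma> q r w v) r * ennreal (2 * C\<^sub>0 / lam powr r)
              * epowr (\<integral>\<^sup>+z. ennreal (\<bar>f z\<bar> powr q * v z powr q) \<partial>lebesgue) (r / q)"
      unfolding E_def P_def X_def by (simp add: mult_ac)
  qed (use C\<^sub>0 in simp)
qed

end
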